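(* Let $n\ge 3$, let $\varepsilon>0$, and assume $f\in C^3(\mathbb{R}^n)$, $g\in C^2(\mathbb{R}^n)$ and $F\in C^2(\mathbb{R}^n\times[0,\infty))$. Let $u$ be a solution of the integral equation \[ u(x,t)=\varepsilon V(x,t)+N(F)(x,t),\qquad (x,t)\in\mathbb{R}^n\times[0,\infty), \] where \[ V(x,t)=\frac{1}{\omega_n}\int_{|\omega|=1}\left(\frac{t\,\omega\cdot\nabla f}{n-2}+f+tg\right)(x+t\omega)\,dS_\omega, \] \[ N(F)(x,t)=\frac{1}{(n-2)\omega_n}\int_0^t(t-\tau)\,d\tau\int_{|\omega|=1}F(x+(t-\tau)\omega,\tau)\,dS_\omega . \] Then $u$ satisfies the initial value problem \[ \begin{cases} \partial_t^2u(x,t)-\Delta u(x,t)=F(x,t)-H(x,t) & \text{in } \mathbb{R}^n\times[0,\infty),\\ u(x,0)=\varepsilon f(x),\quad u_t(x,0)=\varepsilon g(x), & x\in\mathbb{R}^n, \end{cases} \] where \[ \begin{aligned} H(x,t)=&\frac{n-3}{(n-2)\omega_n}\int_0^t d\tau\int_{|\omega|=1}(\partial_tF)(x+(t-\tau)\omega,\tau)\,dS_\omega +\frac{n-3}{(n-2)\omega_n}\int_{|\omega|=1}F(x+t\omega,0)\,dS_\omega\\ &+\frac{\varepsilon(n-3)}{(n-2)\omega_n}\int_{|\omega|=1}\left\{\Delta f+(n-2)\,\omega\cdot\nabla g\right\}(x+t\omega)\,dS_\omega . \end{aligned} \]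
   Context: $\omega_n=2\pi^{n/2}/\Gamma(n/2)$ denotes the surface measure of the unit sphere in $\mathbb{R}^n$, and $dS_\omega$ is the surface measure on the unit sphere $\{|\omega|=1\}$. *)

theory Defs
  imports "HOL-Analysis.Analysis"
begin

text \<open>Surface measure of the unit sphere in R^n: omega_n = 2 pi^(n/2) / Gamma(n/2).\<close>
definition omega_n :: "nat \<Rightarrow> real" where
  "omega_n n = 2 * pi powr (real n / 2) / Gamma (real n / 2)"

text \<open>Integral over the unit sphere with respect to surface measure dS, given via the
  cone (polar coordinates) representation:
  int_{|w|=1} h(w) dS_w = n * int_{|y|<1} h(y/|y|) dy.\<close>
definition sphere_integral :: "('a::euclidean_space \<Rightarrow> real) \<Rightarrow> real" where
  "sphere_integral h = real DIM('a) * integral (ball 0 1) (\<lambda>y. h (y /\<^sub>R norm y))"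

fun Ck_on :: "nat \<Rightarrow> 'a::euclidean_space set \<Rightarrow> ('a \<Rightarrow> real) \<Rightarrow> bool" where
  "Ck_on 0 S f = continuous_on S f"
| "Ck_on (Suc k) S f = (\<exists>Df. (\<forall>x\<in>S. (f has_derivative Df x) (at x within S)) \<and>
                         (\<forall>b\<in>Basis. Ck_on k S (\<lambda>x. Df x b)))"

definition has_second_deriv_within :: "(real \<Rightarrow> real) \<Rightarrow> real \<Rightarrow> real \<Rightarrow> real set \<Rightarrow> bool" where
  "has_second_deriv_within h D2 t S \<longleftrightarrow>
     (\<exists>h'. (\<forall>s\<in>S. (h has_real_derivative h' s) (at s within S)) \<and>
           (h' has_real_derivative D2) (at t within S))"

definition dir_deriv :: "('a::euclidean_space \<Rightarrow> real) \<Rightarrow> 'a \<Rightarrow> 'a \<Rightarrow> real" where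
  "dir_deriv f y v = frechet_derivative f (at y) v"

definition laplacian :: "('a::euclidean_space \<Rightarrow> real) \<Rightarrow> 'a \<Rightarrow> real" where
  "laplacian f y = (\<Sum>b\<in>Basis. dir_deriv (\<lambda>z. dir_deriv f z b) y b)"

definition time_deriv :: "('a \<times> real \<Rightarrow> real) \<Rightarrow> 'a \<Rightarrow> real \<Rightarrow> real" where
  "time_deriv F x \<tau> = (SOME D. ((\<lambda>s. F (x, s)) has_real_derivative D) (at \<tau> within {0..}))"

definition V_term :: "('a::euclidean_space \<Rightarrow> real) \<Rightarrow> ('a \<Rightarrow> real) \<Rightarrow> 'a \<Rightarrow> real \<Rightarrow> real" where
  "V_term f g x t = (1 / omega_n DIM('a)) *
     sphere_integral (\<lambda>\<omega>. t * dir_deriv f (x + t *\<^sub>R \<omega>) \<omega> / (real DIM('a) - 2)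
                          + f (x + t *\<^sub>R \<omega>) + t * g (x + t *\<^sub>R \<omega>))"

definition N_term :: "('a::euclidean_space \<times> real \<Rightarrow> real) \<Rightarrow> 'a \<Rightarrow> real \<Rightarrow> real" where
  "N_term F x t = (1 / ((real DIM('a) - 2) * omega_n DIM('a))) *
     integral {0..t} (\<lambda>\<tau>. (t - \<tau>) * sphere_integral (\<lambda>\<omega>. F (x + (t - \<tau>) *\<^sub>R \<omega>, \<tau>)))"

definition H_term :: "real \<Rightarrow> ('a::euclidean_space \<Rightarrow> real) \<Rightarrow> ('a \<Rightarrow> real) \<Rightarrow> ('a \<times> real \<Rightarrow> real) \<Rightarrow> 'a \<Rightarrow> real \<Rightarrow> real" where
  "H_term \<epsilon> f g F x t =
     (let n = real DIM('a); c = (n - 3) / ((n - 2) * omega_n DIM('a)) in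
       c * integral {0..t} (\<lambda>\<tau>. sphere_integral (\<lambda>\<omega>. time_deriv F (x + (t - \<tau>) *\<^sub>R \<omega>) \<tau>))
     + c * sphere_integral (\<lambda>\<omega>. F (x + t *\<^sub>R \<omega>, 0))
     + \<epsilon> * c * sphere_integral (\<lambda>\<omega>. laplacian f (x + t *\<^sub>R \<omega>)
                                     + (n - 2) * dir_deriv g (x + t *\<^sub>R \<omega>) \<omega>))"

end

theory Submission
  imports Defs
begin

text \<open>
  Write M for the normalised spherical mean. The mean Q(r) of a C2 function h over the sphere of
  radius r about x satisfies Darboux's equation r Q'' + (n - 1) Q' = r M(laplacian h). This comes from
  rotation invariance alone: differentiating M(k o R) along a rotation R in the plane of the axes
  i, j gives M(w_i d_j k - w_j d_i k) = 0; taking k = y_i d_j h(x + r y) and summing over all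
  pairs i, j yields the equation.

  Darboux's equation turns the time derivative of t Q'/(n - 2) + Q into t M(laplacian f)/(n - 2), so one
  derivative of f is saved and V is twice differentiable. In both V and N(F) the second time
  derivative differs from the Laplacian by (n - 3) times a radial derivative, which is where H comes from.
  For N(F) this radial derivative is integrated along the backward cone, and the fundamental theorem
  of calculus for F(x + (t - s) w, s) in s trades it for the time derivative of F and boundary terms.
\<close>

text \<open>A spherical mean is here a ball integral of a radial extension, so Lebesgue measure
  supplies all the symmetry, and rotations stand in for the divergence theorem on the sphere.
  Darboux's equation is kept in its undivided form: the weight t in V and the weight t - tau in N(F)
  are the factor r that it asks for, so nothing is divided by the radius at t = 0 or at the tip of
  the cone. Third derivatives of f enter the second time derivative and the Laplacian of V only
  through the radial derivative of laplacian f, both times with weight t/(n - 2), and therefore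
  cancel. For n = 3 the term H vanishes and the formulas are Kirchhoff's. A second constraint shapes
  the treatment of F, which is given for times \<ge> 0 only. Its full derivative is taken within the
  closed half-space, so F is handled through its time slices, which are C2 on all of R^n, together
  with a separate, possibly one-sided, time derivative.\<close>

section \<open>Normalised spherical means\<close>

definition sphere_mean :: "('a::euclidean_space \<Rightarrow> real) \<Rightarrow> real" where
  "sphere_mean h = sphere_integral h / omega_n DIM('a)"

text \<open>Away from the origin y / norm y is continuous and lies on the sphere, so continuity of h
  on the sphere is enough to control the integrand.\<close>

abbreviation punctured_ball :: "'a::euclidean_space set" where
  "punctured_ball \<equiv> ball 0 1 - {0}"

text \<open>The recursion Gamma (z + 1) = z Gamma z at z = n/2. It makes the dimension factor in
  \<open>sphere_integral\<close> cancel against \<open>omega_n\<close>, so that constants are their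
  own means.\<close>

lemma omega_n_eq_unit_ball_vol: "n > 0 \<Longrightarrow> omega_n n = real n * unit_ball_vol (real n)"
proof -
  assume n: "n > 0"
  then have "real n / 2 \<notin> \<int>\<^sub>\<le>\<^sub>0" "Gamma (real n / 2) > 0"
    by (auto intro!: Gamma_real_pos dest!: nonpos_Ints_nonpos)
  with Gamma_plus1[of "real n / 2"] n have "Gamma (real n / 2 + 1) = real n / 2 * Gamma (real n / 2)"
    by simp
  then show ?thesis
    using n by (simp only: omega_n_def unit_ball_vol_def) (simp add: field_simps)
qed

lemma omega_n_pos: "n > 0 \<Longrightarrow> omega_n n > 0"
  by (simp add: omega_n_eq_unit_ball_vol)

lemma radial_integrable:
  fixes h :: "'a::euclidean_space \<Rightarrow> real"
  assumes "continuous_on (sphere 0 1) h"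
  shows "set_integrable lborel punctured_ball (\<lambda>y. h (y /\<^sub>R norm y))"
proof -
  let ?g = "\<lambda>y::'a. indicator punctured_ball y *\<^sub>R h (y /\<^sub>R norm y)"
  have cont: "continuous_on punctured_ball (\<lambda>y. h (y /\<^sub>R norm y))"
    by (rule continuous_on_compose2[OF assms]) (auto intro!: continuous_intros simp: sgn_div_norm[symmetric] norm_sgn split: if_splits)
  have meas: "?g \<in> borel_measurable borel"
    by (rule borel_measurable_continuous_on_indicator[OF _ cont]) auto
  obtain B where B: "\<And>w. w \<in> sphere 0 1 \<Longrightarrow> norm (h w) \<le> B"
    using compact_imp_bounded[OF compact_continuous_image[OF assms compact_sphere]]
    by (metis bounded_iff imageI)
  \<comment> \<open>\<open>?g\<close> already carries the indicator, because measurability was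
    obtained for the cut-off function; the second indicator is the shape of the boundedness
    criterion and is absorbed at the end.\<close>
  have "integrable lborel (\<lambda>y. indicator punctured_ball y *\<^sub>R ?g y)"
  proof (rule integrableI_bounded_set_indicator[where B=B])
    show "emeasure lborel (punctured_ball::'a set) < \<infinity>"
      by (intro emeasure_bounded_finite) (auto intro: bounded_subset[OF bounded_ball])
    show "AE y in lborel. y \<in> punctured_ball \<longrightarrow> norm (?g y) \<le> B"
      using B by (intro AE_I2) auto
  qed (use meas in auto)
  then show ?thesis
    by (simp add: set_integrable_def indicator_inter_arith[symmetric] flip: mult.assoc)
qed

text \<open>Passage from the gauge integral to the Lebesgue integral, from which additivity,
  monotonicity and change of variables are drawn.\<close>

lemma sphere_integral_eq_set_lebesgue:
  fixes h :: "'a::euclidean_space \<Rightarrow> real"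
  assumes "continuous_on (sphere 0 1) h"
  shows "sphere_integral h = real DIM('a) * (LINT y:punctured_ball|lborel. h (y /\<^sub>R norm y))"
proof -
  have "integral (ball 0 1) (\<lambda>y::'a. h (y /\<^sub>R norm y)) = integral punctured_ball (\<lambda>y. h (y /\<^sub>R norm y))"
    by (rule integral_subset_negligible[symmetric])
      (auto intro: negligible_subset[of "{0}"])
  also have "\<dots> = (LINT y:punctured_ball|lborel. h (y /\<^sub>R norm y))"
    by (rule set_borel_integral_eq_integral(2)[symmetric, OF radial_integrable[OF assms]])
  finally show ?thesis by (simp add: sphere_integral_def)
qed

text \<open>The values at 0 (where y / norm y is 0, off the sphere) do not matter.\<close>

lemma sphere_mean_cong:
  assumes "\<And>w. norm w = 1 \<Longrightarrow> h w = k w"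
  shows "sphere_mean h = sphere_mean k"
proof -
  have "integral (ball 0 1) (\<lambda>y. h (y /\<^sub>R norm y)) = integral (ball 0 1) (\<lambda>y. k (y /\<^sub>R norm y))"
    by (rule integral_spike[of "{0}"]) (auto simp: assms)
  then show ?thesis by (simp add: sphere_mean_def sphere_integral_def)
qed

lemma sphere_mean_const [simp]: "sphere_mean (\<lambda>w::'a::euclidean_space. c) = c"
proof -
  have "integral (ball 0 1) (\<lambda>y::'a. c) = measure lborel (ball (0::'a) 1) * c"
    using has_integral_mult_left[OF has_integral_measure_lborel[of "ball (0::'a) 1"], of c]
    by (simp add: integral_unique emeasure_ball)
  then show ?thesis
    using unit_ball_vol_pos[of "real DIM('a)"]
    by (simp add: sphere_mean_def sphere_integral_def content_ball omega_n_eq_unit_ball_vol del: unit_ball_vol_pos)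
qed

lemma sphere_mean_add:
  fixes h k :: "'a::euclidean_space \<Rightarrow> real"
  assumes "continuous_on (sphere 0 1) h" "continuous_on (sphere 0 1) k"
  shows "sphere_mean (\<lambda>w. h w + k w) = sphere_mean h + sphere_mean k"
  using assms radial_integrable[OF assms(1)] radial_integrable[OF assms(2)]
  by (simp add: sphere_mean_def sphere_integral_eq_set_lebesgue continuous_on_add set_integral_add
      algebra_simps add_divide_distrib)

lemma sphere_mean_cmult: "sphere_mean (\<lambda>w. c * h w) = c * sphere_mean h"
  by (simp add: sphere_mean_def sphere_integral_def)

lemma sphere_mean_diff:
  fixes h k :: "'a::euclidean_space \<Rightarrow> real"
  assumes "continuous_on (sphere 0 1) h" "continuous_on (sphere 0 1) k"
  shows "sphere_mean (\<lambda>w. h w - k w) = sphere_mean h - sphere_mean k"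
  using sphere_mean_add[of h "\<lambda>w. (-1) * k w"] sphere_mean_cmult[of "-1" k] assms
  by (simp add: continuous_on_minus)

lemma sphere_mean_sum:
  fixes h :: "'i \<Rightarrow> 'a::euclidean_space \<Rightarrow> real"
  assumes "\<And>i. i \<in> I \<Longrightarrow> continuous_on (sphere 0 1) (h i)"
  shows "sphere_mean (\<lambda>w. \<Sum>i\<in>I. h i w) = (\<Sum>i\<in>I. sphere_mean (h i))"
  using assms
proof (induction I rule: infinite_finite_induct)
  case (insert i I)
  then show ?case
    by (simp add: sphere_mean_add continuous_on_sum)
qed simp_all

text \<open>Monotonicity applied to h and to -h. The mean is thus a contraction for the sup norm,
  and limits of means reduce to uniform estimates on the compact sphere.\<close>

lemma abs_sphere_mean_le:
  fixes h :: "'a::euclidean_space \<Rightarrow> real"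
  assumes h: "continuous_on (sphere 0 1) h" and B: "\<And>w. norm w = 1 \<Longrightarrow> \<bar>h w\<bar> \<le> B"
  shows "\<bar>sphere_mean h\<bar> \<le> B"
proof -
  have mono: "sphere_mean k \<le> B"
    if k: "continuous_on (sphere 0 1) k" and "\<And>w. norm w = 1 \<Longrightarrow> k w \<le> B" for k :: "'a \<Rightarrow> real"
  proof -
    have "sphere_mean k \<le> sphere_mean (\<lambda>w::'a. B)"
      unfolding sphere_mean_def sphere_integral_eq_set_lebesgue[OF k]
        sphere_integral_eq_set_lebesgue[OF continuous_on_const]
      using omega_n_pos[of "DIM('a)"] that
      by (intro divide_right_mono mult_left_mono set_integral_mono radial_integrable
          continuous_on_const) auto
    then show ?thesis by simp
  qed
  show ?thesis
    using mono[of h] mono[of "\<lambda>w. (-1) * h w"] sphere_mean_cmult[of "-1" h] h B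
    by (fastforce simp: abs_le_iff continuous_on_minus)
qed

section \<open>Rotation invariance of Lebesgue measure and of the spherical mean\<close>

text \<open>
  Fubini applied to the product of f(R x + y) and the indicator of the unit ball at y: both orders of
  integration produce the volume of the ball, so no uniqueness theorem for Haar measure is needed.
\<close>

lemma nn_integral_orthogonal_transformation:
  fixes f :: "'a::euclidean_space \<Rightarrow> ennreal" and R :: "'a \<Rightarrow> 'a"
  assumes R: "orthogonal_transformation R" and [measurable]: "f \<in> borel_measurable borel"
  shows "(\<integral>\<^sup>+x. f (R x) \<partial>lborel) = (\<integral>\<^sup>+x. f x \<partial>lborel)"
proof -
  define m where "m = emeasure lborel (ball (0::'a) 1)"
  have m: "m \<noteq> 0" "m \<noteq> top"
    unfolding m_def using emeasure_ball[of 1 "0::'a"] unit_ball_vol_pos[of "real DIM('a)"]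
    by (auto simp: top_unique simp del: unit_ball_vol_pos)
  have contR: "continuous_on UNIV R"
    by (intro linear_continuous_on linear_conv_bounded_linear[THEN iffD1] orthogonal_transformation_linear R)
  then have [measurable]: "R \<in> borel_measurable borel"
    by (rule borel_measurable_continuous_onI)
  have lin: "linear R" using R by (rule orthogonal_transformation_linear)
  have shift: "(\<integral>\<^sup>+x. g (x + c) \<partial>lborel) = (\<integral>\<^sup>+x. g x \<partial>lborel)"
    if [measurable]: "g \<in> borel_measurable borel" for g :: "'a \<Rightarrow> ennreal" and c
    by (subst (2) lborel_distr_plus[of c, symmetric]) (simp add: nn_integral_distr add.commute)
  define I where "I = (\<lambda>y::'a. indicator (ball 0 1) y :: ennreal)"
  have [measurable]: "I \<in> borel_measurable borel"
    unfolding I_def by (intro borel_measurable_indicator) auto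
  \<comment> \<open>With z = R c, the point z - R x equals R (c - x) and has norm
    \<open>dist c x\<close>. The integral is the volume of a unit ball, whatever z is.\<close>
  have reflect: "(\<integral>\<^sup>+x. I (z - R x) \<partial>lborel) = m" for z
  proof -
    obtain c where c: "z = R c" using orthogonal_transformation_surj[OF R] by (metis surjD)
    have "I (z - R x) = indicator (ball c 1) x" for x
      using R by (auto simp: c I_def indicator_def dist_norm orthogonal_transformation_norm
          simp flip: linear_diff[OF lin])
    then have "(\<integral>\<^sup>+x. I (z - R x) \<partial>lborel) = emeasure lborel (ball c 1)" by simp
    then show ?thesis by (simp add: m_def emeasure_ball)
  qed
  have "m * (\<integral>\<^sup>+x. f (R x) \<partial>lborel) = (\<integral>\<^sup>+y. I y * (\<integral>\<^sup>+x. f (R x) \<partial>lborel) \<partial>lborel)"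
    by (subst nn_integral_multc) (measurable, simp add: m_def I_def)
  also have "\<dots> = (\<integral>\<^sup>+y. I y * (\<integral>\<^sup>+x. f (R x + y) \<partial>lborel) \<partial>lborel)"
  proof (rule nn_integral_cong)
    fix y
    \<comment> \<open>Surjectivity writes the shift y as R c, so f (R x + y) = f (R (x + c)) and
      translation invariance in x applies.\<close>
    obtain c where c: "y = R c" using orthogonal_transformation_surj[OF R] by (metis surjD)
    show "I y * (\<integral>\<^sup>+x. f (R x) \<partial>lborel) = I y * (\<integral>\<^sup>+x. f (R x + y) \<partial>lborel)"
      using shift[of "\<lambda>x. f (R x)" c] by (simp add: c linear_add[OF lin])
  qed
  also have "\<dots> = (\<integral>\<^sup>+y. (\<integral>\<^sup>+x. I y * f (R x + y) \<partial>lborel) \<partial>lborel)"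
    by (simp add: nn_integral_cmult)
  also have "\<dots> = (\<integral>\<^sup>+x. (\<integral>\<^sup>+y. I y * f (R x + y) \<partial>lborel) \<partial>lborel)"
    by (rule lborel_pair.Fubini') measurable
  \<comment> \<open>The substitution z = R x + y in the inner integral moves R from f to the
    indicator.\<close>
  also have "\<dots> = (\<integral>\<^sup>+x. (\<integral>\<^sup>+z. I (z - R x) * f z \<partial>lborel) \<partial>lborel)"
  proof (rule nn_integral_cong)
    fix x
    show "(\<integral>\<^sup>+y. I y * f (R x + y) \<partial>lborel) = (\<integral>\<^sup>+z. I (z - R x) * f z \<partial>lborel)"
      using shift[of "\<lambda>z. I (z - R x) * f z" "R x"] by (simp add: add.commute)
  qed
  also have "\<dots> = (\<integral>\<^sup>+z. (\<integral>\<^sup>+x. I (z - R x) * f z \<partial>lborel) \<partial>lborel)"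
    by (rule lborel_pair.Fubini') measurable
  also have "\<dots> = (\<integral>\<^sup>+z. m * f z \<partial>lborel)"
    by (simp add: nn_integral_multc reflect)
  also have "\<dots> = m * (\<integral>\<^sup>+z. f z \<partial>lborel)"
    by (simp add: nn_integral_cmult)
  finally show ?thesis
    using m by (simp add: ennreal_mult_cancel_left)
qed

lemma distr_lborel_orthogonal_transformation:
  fixes R :: "'a::euclidean_space \<Rightarrow> 'a"
  assumes R: "orthogonal_transformation R"
  shows "distr lborel borel R = lborel"
proof (rule measure_eqI)
  have "continuous_on UNIV R"
    by (intro linear_continuous_on linear_conv_bounded_linear[THEN iffD1] orthogonal_transformation_linear R)
  then have meas [measurable]: "R \<in> borel_measurable borel"
    by (rule borel_measurable_continuous_onI)
  fix A assume "A \<in> sets (distr lborel borel R)"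
  then have [measurable]: "A \<in> sets borel" by simp
  have "emeasure (distr lborel borel R) A = (\<integral>\<^sup>+x. indicator A x \<partial>distr lborel borel R)"
    by simp
  also have "\<dots> = (\<integral>\<^sup>+x. indicator A (R x) \<partial>lborel)"
    by (rule nn_integral_distr) auto
  also have "\<dots> = emeasure lborel A"
    by (subst nn_integral_orthogonal_transformation[OF R]) auto
  finally show "emeasure (distr lborel borel R) A = emeasure lborel A" .
qed simp

text \<open>R preserves norms, hence commutes with the projection y / norm y and preserves the
  punctured ball; what remains is the invariance of \<open>lborel\<close>.\<close>

lemma sphere_mean_orthogonal_transformation:
  fixes h :: "'a::euclidean_space \<Rightarrow> real" and R :: "'a \<Rightarrow> 'a"
  assumes R: "orthogonal_transformation R" and h: "continuous_on (sphere 0 1) h"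
  shows "sphere_mean (\<lambda>w. h (R w)) = sphere_mean h"
proof -
  have contR: "continuous_on UNIV R"
    by (intro linear_continuous_on linear_conv_bounded_linear[THEN iffD1] orthogonal_transformation_linear R)
  then have [measurable]: "R \<in> borel_measurable borel"
    by (rule borel_measurable_continuous_onI)
  have hR: "continuous_on (sphere 0 1) (\<lambda>w. h (R w))"
    by (rule continuous_on_compose2[OF h continuous_on_subset[OF contR]])
      (auto simp: orthogonal_transformation_norm[OF R])
  let ?g = "\<lambda>y::'a. indicator punctured_ball y *\<^sub>R h (y /\<^sub>R norm y)"
  have meas: "?g \<in> borel_measurable borel"
    using radial_integrable[OF h] by (simp add: set_integrable_def borel_measurable_integrable)
  have "?g (R y) = indicator punctured_ball y *\<^sub>R h (R (y /\<^sub>R norm y))" for y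
    using orthogonal_transformation_norm[OF R, of y]
    by (auto simp: indicator_def orthogonal_transformation_scaleR[OF R])
  then have "(LINT y:punctured_ball|lborel. h (R (y /\<^sub>R norm y))) = (\<integral>y. ?g (R y) \<partial>lborel)"
    by (simp add: set_lebesgue_integral_def)
  also have "\<dots> = (\<integral>y. ?g y \<partial>distr lborel borel R)"
    by (rule integral_distr[symmetric]) (use meas in auto)
  also have "\<dots> = (LINT y:punctured_ball|lborel. h (y /\<^sub>R norm y))"
    by (simp only: distr_lborel_orthogonal_transformation[OF R] set_lebesgue_integral_def)
  finally show ?thesis
    by (simp add: sphere_mean_def sphere_integral_eq_set_lebesgue[OF h] sphere_integral_eq_set_lebesgue[OF hR])
qed

section \<open>Differentiating spherical means\<close>

lemma continuous_on_slice:
  assumes "continuous_on (U \<times> S) (\<lambda>(p, w). k p w)" "p \<in> U"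
  shows "continuous_on S (k p)"
proof -
  have "continuous_on S (\<lambda>w. (p, w))"
    by (intro continuous_intros)
  from continuous_on_compose2[OF assms(1) this] assms(2) show ?thesis by auto
qed

text \<open>Compactness of the sphere makes k q w close to k p w uniformly in w, and the contraction
  estimate passes this on to the means.\<close>

lemma continuous_on_sphere_mean:
  fixes k :: "'p::topological_space \<Rightarrow> 'a::euclidean_space \<Rightarrow> real"
  assumes k: "continuous_on (U \<times> sphere 0 1) (\<lambda>(p, w). k p w)"
  shows "continuous_on U (\<lambda>p. sphere_mean (k p))"
proof -
  have slice: "continuous_on (sphere 0 1) (k p)" if "p \<in> U" for p
    using k that by (rule continuous_on_slice)
  show ?thesis
    unfolding continuous_on_def
  proof (intro ballI tendstoI)
    fix p and e :: real assume p: "p \<in> U" and "0 < e"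
    \<comment> \<open>The uniform bound yields only \<open>\<le>\<close>, so half of
      \<open>e\<close> is spent to reach a strict inequality.\<close>
    then have e: "0 < e / 2" by simp
    obtain X0 where X0: "p \<in> X0" "open X0"
      and bound: "\<forall>q\<in>X0 \<inter> U. \<forall>w\<in>sphere 0 1. dist (case (q, w) of (p, w) \<Rightarrow> k p w) (case (p, w) of (p, w) \<Rightarrow> k p w) \<le> e / 2"
      by (rule continuous_on_prod_compactE[OF k compact_sphere p e])
    have "\<forall>\<^sub>F q in at p within U. q \<in> X0 \<inter> U"
      using X0 eventually_at_topological by auto
    then show "\<forall>\<^sub>F q in at p within U. dist (sphere_mean (k q)) (sphere_mean (k p)) < e"
    proof eventually_elim
      case (elim q)
      then have "\<bar>sphere_mean (\<lambda>w. k q w - k p w)\<bar> \<le> e / 2"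
        using bound p by (intro abs_sphere_mean_le continuous_on_diff slice) (auto simp: dist_real_def)
      then show ?case
        using \<open>0 < e\<close> elim p by (simp add: sphere_mean_diff slice dist_real_def)
    qed
  qed
qed

text \<open>Differentiation under the integral, again by uniformity in w. The set I is kept general:
  it is the whole line for rotations and for radial derivatives, and \<open>{0..t}\<close> on the
  backward cone, where only one-sided derivatives are at hand at the ends.\<close>

lemma has_real_derivative_sphere_mean:
  fixes k k' :: "real \<Rightarrow> 'a::euclidean_space \<Rightarrow> real"
  assumes "convex I" "s \<in> I"
    and k: "\<And>s. s \<in> I \<Longrightarrow> continuous_on (sphere 0 1) (k s)"
    and deriv: "\<And>s w. s \<in> I \<Longrightarrow> norm w = 1 \<Longrightarrow>
      ((\<lambda>s. k s w) has_real_derivative k' s w) (at s within I)"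
    and k': "continuous_on (I \<times> sphere 0 1) (\<lambda>(s, w). k' s w)"
  shows "((\<lambda>s. sphere_mean (k s)) has_real_derivative sphere_mean (k' s)) (at s within I)"
proof -
  have slice: "continuous_on (sphere 0 1) (k' p)" if "p \<in> I" for p
    using k' that by (rule continuous_on_slice)
  have "((\<lambda>s. sphere_mean (k s)) has_derivative (\<lambda>h. sphere_mean (k' s) * h)) (at s within I)"
    unfolding has_derivative_within_alt
  proof (intro conjI allI impI)
    show "bounded_linear ((*) (sphere_mean (k' s)))"
      by (rule bounded_linear_mult_right)
    fix e :: real assume "0 < e"
    obtain X0 where X0: "s \<in> X0" "open X0"
      and bound: "\<forall>q\<in>X0 \<inter> I. \<forall>w\<in>sphere 0 1. dist (case (q, w) of (p, w) \<Rightarrow> k' p w) (case (s, w) of (p, w) \<Rightarrow> k' p w) \<le> e"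
      by (rule continuous_on_prod_compactE[OF k' compact_sphere \<open>s \<in> I\<close> \<open>0 < e\<close>])
    obtain d where d: "d > 0" "ball s d \<subseteq> X0"
      using X0 open_contains_ball by blast
    have "norm (sphere_mean (k y) - sphere_mean (k s) - sphere_mean (k' s) * (y - s)) \<le> e * norm (y - s)"
      if y: "y \<in> I" "norm (y - s) < d" for y
    proof -
      have pointwise: "\<bar>k y w - k s w - (y - s) * k' s w\<bar> \<le> e * norm (y - s)" if w: "norm w = 1" for w
      proof -
        \<comment> \<open>Subtracting z * k' s w leaves a function of z with derivative k' z w - k'
          s w, which is at most e near s for all w at once. The mean value inequality on the convex
          set \<open>?J\<close> then bounds the remainder.\<close>
        let ?J = "ball s d \<inter> I"
        have "norm ((\<lambda>z. k z w - z * k' s w) y - (\<lambda>z. k z w - z * k' s w) s) \<le> e * norm (y - s)"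
        proof (rule differentiable_bound[of ?J _ "\<lambda>z h. h * (k' z w - k' s w)"])
          show "convex ?J" by (intro convex_Int convex_ball \<open>convex I\<close>)
          show "y \<in> ?J" "s \<in> ?J" using y d \<open>s \<in> I\<close> by (auto simp: dist_norm norm_minus_commute)
          fix z assume z: "z \<in> ?J"
          have "((\<lambda>z. k z w - z * k' s w) has_real_derivative k' z w - k' s w) (at z within ?J)"
            using z w by (auto intro!: derivative_eq_intros DERIV_subset[OF deriv])
          then show "((\<lambda>z. k z w - z * k' s w) has_derivative (\<lambda>h. h * (k' z w - k' s w))) (at z within ?J)"
            by (simp add: has_field_derivative_def mult_commute_abs)
          have "\<bar>k' z w - k' s w\<bar> \<le> e"
            using z w d bound by (fastforce simp: dist_real_def)
          then show "onorm (\<lambda>h. h * (k' z w - k' s w)) \<le> e"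
            by (intro onorm_le) (simp add: abs_mult mult.commute[of e] mult_left_mono)
        qed
        then show ?thesis by (simp add: algebra_simps)
      qed
      have "\<bar>sphere_mean (\<lambda>w. k y w - k s w - (y - s) * k' s w)\<bar> \<le> e * norm (y - s)"
        using y \<open>s \<in> I\<close> pointwise
        by (intro abs_sphere_mean_le continuous_intros k slice) auto
      moreover have "sphere_mean (\<lambda>w. k y w - k s w - (y - s) * k' s w)
          = sphere_mean (k y) - sphere_mean (k s) - sphere_mean (k' s) * (y - s)"
        using y \<open>s \<in> I\<close>
        by (simp add: sphere_mean_diff sphere_mean_cmult k slice continuous_intros)
      ultimately show ?thesis by simp
    qed
    with d(1) show "\<exists>d>0. \<forall>y\<in>I. norm (y - s) < d \<longrightarrow>
        norm (sphere_mean (k y) - sphere_mean (k s) - sphere_mean (k' s) * (y - s)) \<le> e * norm (y - s)"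
      by blast
  qed
  then show ?thesis by (simp add: has_field_derivative_def)
qed

section \<open>Rotations in coordinate planes and tangential derivatives\<close>

text \<open>Writing the rotation as the identity plus a correction in the span of i and j leaves the
  orthogonal complement visibly fixed and makes the derivative in the angle immediate.\<close>

definition plane_rotation :: "'a::euclidean_space \<Rightarrow> 'a \<Rightarrow> real \<Rightarrow> 'a \<Rightarrow> 'a" where
  "plane_rotation i j \<theta> y = y + ((cos \<theta> - 1) * (y \<bullet> i) - sin \<theta> * (y \<bullet> j)) *\<^sub>R i
     + ((cos \<theta> - 1) * (y \<bullet> j) + sin \<theta> * (y \<bullet> i)) *\<^sub>R j"

lemma orthogonal_transformation_plane_rotation:
  assumes "i \<in> Basis" "j \<in> Basis" "i \<noteq> j"
  shows "orthogonal_transformation (plane_rotation i j \<theta>)"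
  unfolding orthogonal_transformation_def
proof (intro conjI allI)
  show "linear (plane_rotation i j \<theta>)"
    by (rule linearI) (simp_all add: plane_rotation_def algebra_simps inner_simps)
  fix v w :: 'a
  define c s where "c = cos \<theta>" and "s = sin \<theta>"
  have cs: "s * s = 1 - c * c"
    using sin_squared_eq[of \<theta>] by (simp add: c_def s_def power2_eq_square)
  have ij: "i \<bullet> i = 1" "j \<bullet> j = 1" "i \<bullet> j = 0" "j \<bullet> i = 0"
    using assms by (auto simp: inner_Basis)
  define a b a' b' where "a = v \<bullet> i" and "b = v \<bullet> j" and "a' = w \<bullet> i" and "b' = w \<bullet> j"
  have "plane_rotation i j \<theta> v \<bullet> plane_rotation i j \<theta> w = v \<bullet> w
      + (((c - 1) * a - s * b) * a' + ((c - 1) * b + s * a) * b'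
      + ((c - 1) * a' - s * b') * a + ((c - 1) * b' + s * a') * b
      + ((c - 1) * a - s * b) * ((c - 1) * a' - s * b')
      + ((c - 1) * b + s * a) * ((c - 1) * b' + s * a'))"
    unfolding plane_rotation_def
    by (simp add: inner_add_left inner_add_right ij inner_commute[of i w] inner_commute[of j w]
        flip: c_def s_def a_def b_def a'_def b'_def) (simp add: algebra_simps)
  \<comment> \<open>The bracket equals (c * c + s * s - 1) * (a * a' + b * b').\<close>
  also have "\<dots> = v \<bullet> w"
    using cs by algebra
  finally show "plane_rotation i j \<theta> v \<bullet> plane_rotation i j \<theta> w = v \<bullet> w" .
qed

lemma sphere_mean_rotational_derivative:
  fixes k :: "'a::euclidean_space \<Rightarrow> real"
  assumes ij: "i \<in> Basis" "j \<in> Basis" "i \<noteq> j"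
    and k: "\<And>y. (k has_derivative k' y) (at y)"
    and k': "\<And>b. b \<in> Basis \<Longrightarrow> continuous_on UNIV (\<lambda>y. k' y b)"
  shows "sphere_mean (\<lambda>w. (w \<bullet> i) * k' w j - (w \<bullet> j) * k' w i) = 0"
proof -
  let ?R = "plane_rotation i j"
  \<comment> \<open>The velocity of the curve
    \<open>\<lambda>\<theta>. plane_rotation i j \<theta> w\<close>. At angle 0 it is w_i j - w_j i,
    the tangential direction in the claim.\<close>
  define v where "v = (\<lambda>\<theta> (w::'a). (- sin \<theta> * (w \<bullet> i) - cos \<theta> * (w \<bullet> j)) *\<^sub>R i
      + (- sin \<theta> * (w \<bullet> j) + cos \<theta> * (w \<bullet> i)) *\<^sub>R j)"
  have lin: "linear (k' y)" for y
    using k by (rule has_derivative_linear)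
  have k'v: "k' y (v \<theta> w) = (- sin \<theta> * (w \<bullet> i) - cos \<theta> * (w \<bullet> j)) * k' y i
      + (- sin \<theta> * (w \<bullet> j) + cos \<theta> * (w \<bullet> i)) * k' y j" for y \<theta> w
    by (simp add: v_def linear_add[OF lin] linear_cmul[OF lin] linear_diff[OF lin] algebra_simps)
  have kcont: "continuous_on UNIV k"
    using k by (meson continuous_at_imp_continuous_on has_derivative_continuous)
  have "((\<lambda>\<theta>. sphere_mean (\<lambda>w. k (?R \<theta> w))) has_real_derivative
      sphere_mean (\<lambda>w. k' (?R 0 w) (v 0 w))) (at 0 within UNIV)"
  proof (rule has_real_derivative_sphere_mean)
    show "continuous_on (sphere 0 1) (\<lambda>w. k (?R \<theta> w))" for \<theta>
      by (rule continuous_on_compose2[OF kcont]) (auto simp: plane_rotation_def intro!: continuous_intros)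
    have R': "((\<lambda>\<theta>. ?R \<theta> w) has_vector_derivative v \<theta> w) (at \<theta>)" for \<theta> w
      unfolding plane_rotation_def v_def by (auto intro!: derivative_eq_intros)
    show "((\<lambda>\<theta>. k (?R \<theta> w)) has_real_derivative k' (?R \<theta> w) (v \<theta> w)) (at \<theta> within UNIV)" for \<theta> w
      using vector_derivative_diff_chain_within[OF R', of k "k' (?R \<theta> w)" \<theta> w] k
      by (auto simp: o_def has_real_derivative_iff_has_vector_derivative has_derivative_at_withinI)
    show "continuous_on (UNIV \<times> sphere 0 1) (\<lambda>(\<theta>, w). k' (?R \<theta> w) (v \<theta> w))"
      unfolding k'v split_beta plane_rotation_def
      by (intro continuous_intros continuous_on_compose2[OF k'] ij) auto
  qed auto
  moreover have "(\<lambda>\<theta>. sphere_mean (\<lambda>w. k (?R \<theta> w))) = (\<lambda>\<theta>. sphere_mean k)"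
    using sphere_mean_orthogonal_transformation[OF orthogonal_transformation_plane_rotation[OF ij]]
      continuous_on_subset[OF kcont] by blast
  ultimately have "sphere_mean (\<lambda>w. k' (?R 0 w) (v 0 w)) = 0"
    using DERIV_unique DERIV_const by metis
  then show ?thesis
    by (simp add: k'v) (simp add: plane_rotation_def)
qed

text \<open>Sum of the rotational derivatives of (y . i) k in the planes (i, j) over i.\<close>

lemma sphere_mean_tangential_divergence:
  fixes k :: "'a::euclidean_space \<Rightarrow> real"
  assumes j: "j \<in> Basis"
    and k: "\<And>y. (k has_derivative k' y) (at y)"
    and k': "\<And>b. b \<in> Basis \<Longrightarrow> continuous_on UNIV (\<lambda>y. k' y b)"
  shows "sphere_mean (\<lambda>w. k' w j)
    = sphere_mean (\<lambda>w. (w \<bullet> j) * k' w w) + (real DIM('a) - 1) * sphere_mean (\<lambda>w. (w \<bullet> j) * k w)"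
proof -
  have lin: "linear (k' y)" for y
    using k by (rule has_derivative_linear)
  have kcont: "continuous_on S k" for S
    using k by (meson continuous_at_imp_continuous_on has_derivative_continuous)
  have cont: "continuous_on (sphere 0 1) (\<lambda>w. k' w b)" if "b \<in> Basis" for b
    using k'[OF that] by (rule continuous_on_subset) auto
  have k'w: "k' w w = (\<Sum>i\<in>Basis. (w \<bullet> i) * k' w i)" for w
    by (subst (2) euclidean_representation[of w, symmetric], subst linear_sum[OF lin])
       (simp add: linear_cmul[OF lin])
  have cont': "continuous_on (sphere 0 1) (\<lambda>w. k' w w)"
    unfolding k'w by (intro continuous_intros cont)
  have *: "sphere_mean (\<lambda>w. (w \<bullet> i)\<^sup>2 * k' w j - (w \<bullet> j) * ((w \<bullet> i) * k' w i) - (w \<bullet> j) * k w) = 0"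
    if i: "i \<in> Basis - {j}" for i
  proof -
    have ij: "i \<in> Basis" "i \<noteq> j" using i by auto
    have "((\<lambda>y. (y \<bullet> i) * k y) has_derivative (\<lambda>h. (y \<bullet> i) * k' y h + (h \<bullet> i) * k y)) (at y)" for y
      by (auto intro!: derivative_eq_intros k)
    from sphere_mean_rotational_derivative[OF ij(1) j ij(2) this]
    have "sphere_mean (\<lambda>w. (w \<bullet> i) * ((w \<bullet> i) * k' w j + (j \<bullet> i) * k w)
        - (w \<bullet> j) * ((w \<bullet> i) * k' w i + (i \<bullet> i) * k w)) = 0"
      by (simp add: k' kcont continuous_intros)
    then show ?thesis
      using ij j by (simp add: inner_Basis power2_eq_square algebra_simps)
  qed
  have "0 = sphere_mean (\<lambda>w. \<Sum>i\<in>Basis - {j}. (w \<bullet> i)\<^sup>2 * k' w j - (w \<bullet> j) * ((w \<bullet> i) * k' w i) - (w \<bullet> j) * k w)"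
    by (subst sphere_mean_sum) (auto intro!: continuous_intros cont kcont j simp: * simp del: Diff_iff)
  \<comment> \<open>Each of the n - 1 indices i contributes one copy of
    \<open>(w \<bullet> j) * k w\<close>. Since \<open>norm w = 1\<close>, the squares over i
    \<noteq> j add up to 1 - w_j^2, and the two w_j^2 terms that arise cancel.\<close>
  also have "\<dots> = sphere_mean (\<lambda>w. k' w j - (w \<bullet> j) * k' w w - (real DIM('a) - 1) * ((w \<bullet> j) * k w))"
  proof (rule sphere_mean_cong)
    fix w :: 'a assume "norm w = 1"
    then have "1 = (\<Sum>i\<in>Basis. (w \<bullet> i)\<^sup>2)"
      using euclidean_inner[of w w] norm_eq_sqrt_inner[of w] by (simp add: power2_eq_square)
    then have 1: "(\<Sum>i\<in>Basis - {j}. (w \<bullet> i)\<^sup>2) = 1 - (w \<bullet> j)\<^sup>2"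
      using j by (simp add: sum_diff1)
    have 2: "(\<Sum>i\<in>Basis - {j}. (w \<bullet> i) * k' w i) = k' w w - (w \<bullet> j) * k' w j"
      using j by (simp add: k'w sum_diff1)
    have "real (card (Basis - {j})) = real DIM('a) - 1"
      using j DIM_positive[where 'a='a] by (simp add: of_nat_diff)
    then have "(\<Sum>i\<in>Basis - {j}. (w \<bullet> i)\<^sup>2 * k' w j - (w \<bullet> j) * ((w \<bullet> i) * k' w i) - (w \<bullet> j) * k w)
        = (1 - (w \<bullet> j)\<^sup>2) * k' w j - (w \<bullet> j) * (k' w w - (w \<bullet> j) * k' w j) - (real DIM('a) - 1) * ((w \<bullet> j) * k w)"
      by (simp add: sum_subtractf flip: 1 2 sum_distrib_left sum_distrib_right)
    then show "(\<Sum>i\<in>Basis - {j}. (w \<bullet> i)\<^sup>2 * k' w j - (w \<bullet> j) * ((w \<bullet> i) * k' w i) - (w \<bullet> j) * k w)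
        = k' w j - (w \<bullet> j) * k' w w - (real DIM('a) - 1) * ((w \<bullet> j) * k w)"
      by (simp add: algebra_simps power2_eq_square)
  qed
  also have "\<dots> = sphere_mean (\<lambda>w. k' w j) - sphere_mean (\<lambda>w. (w \<bullet> j) * k' w w)
      - (real DIM('a) - 1) * sphere_mean (\<lambda>w. (w \<bullet> j) * k w)"
    by (simp add: sphere_mean_diff sphere_mean_cmult continuous_intros cont cont' j kcont)
  finally show ?thesis by simp
qed

section \<open>Functions of class Ck and the Darboux equation\<close>

lemma dir_deriv_eqI: "(f has_derivative f') (at x) \<Longrightarrow> dir_deriv f x = f'"
  by (simp add: fun_eq_iff dir_deriv_def flip: frechet_derivative_at)

text \<open>On the whole space the Frechet derivative is unique, so the witness hidden in
  \<open>Ck_on\<close> is \<open>dir_deriv\<close> itself.\<close>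

lemma Ck_on_has_derivative:
  assumes "Ck_on (Suc k) UNIV f"
  shows "(f has_derivative dir_deriv f x) (at x)"
proof -
  from assms obtain Df where "\<And>x. (f has_derivative Df x) (at x)" by auto
  then show ?thesis using dir_deriv_eqI by metis
qed

lemma Ck_on_dir_deriv:
  assumes "Ck_on (Suc k) UNIV f" "b \<in> Basis"
  shows "Ck_on k UNIV (\<lambda>x. dir_deriv f x b)"
proof -
  from assms obtain Df where Df: "\<And>x. (f has_derivative Df x) (at x)" "Ck_on k UNIV (\<lambda>x. Df x b)" by auto
  then have "dir_deriv f = Df" by (intro ext) (simp add: dir_deriv_eqI[OF Df(1)])
  with Df show ?thesis by simp
qed

lemma Ck_on_imp_continuous_on:
  assumes "Ck_on k S f"
  shows "continuous_on S f"
  using assms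
  by (cases k) (auto intro: has_derivative_continuous_on)

lemma Ck_on_SucD: "Ck_on (Suc k) S f \<Longrightarrow> Ck_on k S f"
proof (induction k arbitrary: f)
  case 0
  then show ?case using Ck_on_imp_continuous_on[of "Suc 0"] by (simp del: Ck_on.simps add: Ck_on.simps(1))
next
  case (Suc k)
  then obtain Df where "\<forall>x\<in>S. (f has_derivative Df x) (at x within S)"
      "\<forall>b\<in>Basis. Ck_on (Suc k) S (\<lambda>x. Df x b)"
    by (subst (asm) (2) Ck_on.simps) blast
  with Suc.IH show ?case by (subst Ck_on.simps) blast
qed

lemma Ck_on_add: "Ck_on k S f \<Longrightarrow> Ck_on k S g \<Longrightarrow> Ck_on k S (\<lambda>x. f x + g x)"
proof (induction k arbitrary: f g)
  case (Suc k)
  from Suc.prems obtain Df Dg where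
    "\<forall>x\<in>S. (f has_derivative Df x) (at x within S)" "\<forall>b\<in>Basis. Ck_on k S (\<lambda>x. Df x b)"
    "\<forall>x\<in>S. (g has_derivative Dg x) (at x within S)" "\<forall>b\<in>Basis. Ck_on k S (\<lambda>x. Dg x b)"
    by auto
  then show ?case
    by (auto intro!: exI[of _ "\<lambda>x h. Df x h + Dg x h"] has_derivative_add Suc.IH)
qed (simp add: continuous_on_add)

lemma Ck_on_const: "Ck_on k S (\<lambda>x. c)"
  by (induction k arbitrary: c) (auto intro!: exI[of _ "\<lambda>x h. 0"])

lemma Ck_on_sum:
  assumes "\<And>i. i \<in> I \<Longrightarrow> Ck_on k S (f i)"
  shows "Ck_on k S (\<lambda>x. \<Sum>i\<in>I. f i x)"
  using assms by (induction I rule: infinite_finite_induct) (auto intro: Ck_on_add Ck_on_const)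

lemma Ck_on_laplacian:
  assumes "Ck_on (Suc (Suc k)) UNIV f"
  shows "Ck_on k UNIV (laplacian f)"
  unfolding laplacian_def using assms by (intro Ck_on_sum Ck_on_dir_deriv) auto

lemma dir_deriv_sum:
  assumes "\<And>i. i \<in> I \<Longrightarrow> Ck_on (Suc k) UNIV (f i)"
  shows "dir_deriv (\<lambda>y. \<Sum>i\<in>I. f i y) x v = (\<Sum>i\<in>I. dir_deriv (f i) x v)"
proof -
  have "((\<lambda>y. \<Sum>i\<in>I. f i y) has_derivative (\<lambda>v. \<Sum>i\<in>I. dir_deriv (f i) x v)) (at x)"
    using Ck_on_has_derivative[OF assms] by (rule has_derivative_sum)
  then show ?thesis by (simp add: dir_deriv_eqI)
qed

lemma dir_deriv_scaleR:
  assumes "Ck_on (Suc k) UNIV f"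
  shows "dir_deriv f x (c *\<^sub>R v) = c * dir_deriv f x v"
  using linear_cmul[OF has_derivative_linear[OF Ck_on_has_derivative[OF assms]]] by simp

lemma dir_deriv_eq_sum:
  assumes "Ck_on (Suc k) UNIV f"
  shows "dir_deriv f x v = (\<Sum>b\<in>Basis. (v \<bullet> b) * dir_deriv f x b)"
proof -
  have lin: "linear (dir_deriv f x)"
    using Ck_on_has_derivative[OF assms] by (rule has_derivative_linear)
  show ?thesis
    by (subst euclidean_representation[of v, symmetric], subst linear_sum[OF lin])
       (simp add: linear_cmul[OF lin])
qed

section \<open>Derivatives along lines and symmetry of mixed second derivatives\<close>

lemma Ck_on_DERIV_line:
  assumes "Ck_on (Suc k) UNIV f"
  shows "((\<lambda>s. f (a + s *\<^sub>R v)) has_real_derivative dir_deriv f (a + s *\<^sub>R v) v) (at s)"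
proof -
  have "((\<lambda>s. a + s *\<^sub>R v) has_vector_derivative v) (at s)"
    by (auto intro!: derivative_eq_intros)
  from vector_derivative_diff_chain_within[OF this, of f "dir_deriv f (a + s *\<^sub>R v)"] show ?thesis
    using Ck_on_has_derivative[OF assms]
    by (simp add: o_def has_real_derivative_iff_has_vector_derivative has_derivative_at_withinI)
qed

text \<open>The left-hand side is symmetric in b and c, which is why mixed derivatives commute.\<close>

lemma dir_deriv_mean_value:
  fixes f :: "'a::euclidean_space \<Rightarrow> real"
  assumes f: "Ck_on 2 UNIV f" and b: "b \<in> Basis" and "h > 0"
  shows "\<exists>s t. 0 < s \<and> s < h \<and> 0 < t \<and> t < h \<and>
    f (x + h *\<^sub>R b + h *\<^sub>R c) - f (x + h *\<^sub>R b) - f (x + h *\<^sub>R c) + f x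
      = h * h * dir_deriv (\<lambda>y. dir_deriv f y b) (x + s *\<^sub>R b + t *\<^sub>R c) c"
proof -
  have f1: "Ck_on (Suc 1) UNIV f" using f by (simp add: numeral_2_eq_2)
  have fb: "Ck_on (Suc 0) UNIV (\<lambda>y. dir_deriv f y b)"
    using Ck_on_dir_deriv[OF f1 b] by simp
  \<comment> \<open>The second difference is an increment in s of a first difference in direction c.
    One mean value step in s along b and one in t along c produce the mixed derivative.\<close>
  have "((\<lambda>s. f (x + h *\<^sub>R c + s *\<^sub>R b) - f (x + s *\<^sub>R b)) has_real_derivative
      dir_deriv f (x + h *\<^sub>R c + s *\<^sub>R b) b - dir_deriv f (x + s *\<^sub>R b) b) (at s)" for s
    by (intro derivative_intros Ck_on_DERIV_line[OF f1])
  with MVT2[OF \<open>h > 0\<close>] obtain s where s: "0 < s" "s < h" and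
    "f (x + h *\<^sub>R c + h *\<^sub>R b) - f (x + h *\<^sub>R b) - (f (x + h *\<^sub>R c) - f x)
      = h * (dir_deriv f (x + h *\<^sub>R c + s *\<^sub>R b) b - dir_deriv f (x + s *\<^sub>R b) b)"
    by (force)
  moreover obtain t where t: "0 < t" "t < h" and
    "dir_deriv f (x + s *\<^sub>R b + h *\<^sub>R c) b - dir_deriv f (x + s *\<^sub>R b) b
      = h * dir_deriv (\<lambda>y. dir_deriv f y b) (x + s *\<^sub>R b + t *\<^sub>R c) c"
    using MVT2[OF \<open>h > 0\<close> Ck_on_DERIV_line[OF fb, of "x + s *\<^sub>R b" c]] by force
  ultimately show ?thesis
    by (intro exI[of _ s] exI[of _ t]) (simp add: algebra_simps)
qed

text \<open>Two mixed derivatives, at two points within distance O(h) of x, equal the same second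
  difference divided by h^2; h tends to 0. This serves the spatial derivative of V, where the
  derivative of the radial derivative of f has to become the radial derivative of
  \<open>\<lambda>y. dir_deriv f y b\<close>.\<close>

lemma dir_deriv_commute:
  fixes f :: "'a::euclidean_space \<Rightarrow> real"
  assumes f: "Ck_on 2 UNIV f" and bc: "b \<in> Basis" "c \<in> Basis"
  shows "dir_deriv (\<lambda>y. dir_deriv f y b) x c = dir_deriv (\<lambda>y. dir_deriv f y c) x b"
proof -
  have f1: "Ck_on (Suc (Suc 0)) UNIV f" using f by (simp add: numeral_2_eq_2)
  have cont: "isCont (\<lambda>y. dir_deriv (\<lambda>y. dir_deriv f y d) y e) x" if "d \<in> Basis" "e \<in> Basis" for d e
    using Ck_on_imp_continuous_on[OF Ck_on_dir_deriv[OF Ck_on_dir_deriv[OF f1]]] that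
    by (simp add: continuous_on_eq_continuous_at)
  define h where "h n = inverse (real (Suc n))" for n
  have h: "h n > 0" for n by (simp add: h_def)
  have h0: "h \<longlonglongrightarrow> 0" unfolding h_def by (rule LIMSEQ_inverse_real_of_nat)
  have "\<forall>n. \<exists>s t s' t'. 0 < s \<and> s < h n \<and> 0 < t \<and> t < h n \<and> 0 < s' \<and> s' < h n \<and> 0 < t' \<and> t' < h n \<and>
    dir_deriv (\<lambda>y. dir_deriv f y b) (x + s *\<^sub>R b + t *\<^sub>R c) c
      = dir_deriv (\<lambda>y. dir_deriv f y c) (x + s' *\<^sub>R c + t' *\<^sub>R b) b"
  proof
    fix n
    obtain s t where st: "0 < s" "s < h n" "0 < t" "t < h n" and 1:
      "f (x + h n *\<^sub>R b + h n *\<^sub>R c) - f (x + h n *\<^sub>R b) - f (x + h n *\<^sub>R c) + f x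
        = h n * h n * dir_deriv (\<lambda>y. dir_deriv f y b) (x + s *\<^sub>R b + t *\<^sub>R c) c"
      using dir_deriv_mean_value[OF f bc(1) h] by blast
    obtain s' t' where st': "0 < s'" "s' < h n" "0 < t'" "t' < h n" and 2:
      "f (x + h n *\<^sub>R c + h n *\<^sub>R b) - f (x + h n *\<^sub>R c) - f (x + h n *\<^sub>R b) + f x
        = h n * h n * dir_deriv (\<lambda>y. dir_deriv f y c) (x + s' *\<^sub>R c + t' *\<^sub>R b) b"
      using dir_deriv_mean_value[OF f bc(2) h] by blast
    have "h n * h n * dir_deriv (\<lambda>y. dir_deriv f y b) (x + s *\<^sub>R b + t *\<^sub>R c) c
        = h n * h n * dir_deriv (\<lambda>y. dir_deriv f y c) (x + s' *\<^sub>R c + t' *\<^sub>R b) b"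
      using 1 2 unfolding add.assoc[of x "h n *\<^sub>R b" "h n *\<^sub>R c"] add.assoc[of x "h n *\<^sub>R c" "h n *\<^sub>R b"]
        add.commute[of "h n *\<^sub>R b" "h n *\<^sub>R c"] by linarith
    then have "dir_deriv (\<lambda>y. dir_deriv f y b) (x + s *\<^sub>R b + t *\<^sub>R c) c
        = dir_deriv (\<lambda>y. dir_deriv f y c) (x + s' *\<^sub>R c + t' *\<^sub>R b) b"
      using h[of n] by simp
    with st st' show "\<exists>s t s' t'. 0 < s \<and> s < h n \<and> 0 < t \<and> t < h n \<and> 0 < s' \<and> s' < h n \<and> 0 < t' \<and> t' < h n \<and>
      dir_deriv (\<lambda>y. dir_deriv f y b) (x + s *\<^sub>R b + t *\<^sub>R c) c
        = dir_deriv (\<lambda>y. dir_deriv f y c) (x + s' *\<^sub>R c + t' *\<^sub>R b) b"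
      by blast
  qed
  then obtain s t s' t' where bounds:
      "\<And>n. 0 < s n" "\<And>n. s n < h n" "\<And>n. 0 < t n" "\<And>n. t n < h n"
      "\<And>n. 0 < s' n" "\<And>n. s' n < h n" "\<And>n. 0 < t' n" "\<And>n. t' n < h n"
    and eq: "\<And>n. dir_deriv (\<lambda>y. dir_deriv f y b) (x + s n *\<^sub>R b + t n *\<^sub>R c) c
      = dir_deriv (\<lambda>y. dir_deriv f y c) (x + s' n *\<^sub>R c + t' n *\<^sub>R b) b"
    by metis
  have lim0: "r \<longlonglongrightarrow> 0" if "\<And>n. 0 < r n" "\<And>n. r n < h n" for r :: "nat \<Rightarrow> real"
    by (rule tendsto_sandwich[OF _ _ tendsto_const h0]) (use that in \<open>auto intro!: always_eventually less_imp_le\<close>)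
  have "(\<lambda>n. x + s n *\<^sub>R b + t n *\<^sub>R c) \<longlonglongrightarrow> x + 0 *\<^sub>R b + 0 *\<^sub>R c"
    by (intro tendsto_intros lim0 bounds)
  from isCont_tendsto_compose[OF _ this] have
    1: "(\<lambda>n. dir_deriv (\<lambda>y. dir_deriv f y b) (x + s n *\<^sub>R b + t n *\<^sub>R c) c)
      \<longlonglongrightarrow> dir_deriv (\<lambda>y. dir_deriv f y b) x c"
    using cont[OF bc] by fastforce
  have "(\<lambda>n. x + s' n *\<^sub>R c + t' n *\<^sub>R b) \<longlonglongrightarrow> x + 0 *\<^sub>R c + 0 *\<^sub>R b"
    by (intro tendsto_intros lim0 bounds)
  from isCont_tendsto_compose[OF _ this] have
    2: "(\<lambda>n. dir_deriv (\<lambda>y. dir_deriv f y c) (x + s' n *\<^sub>R c + t' n *\<^sub>R b) b)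
      \<longlonglongrightarrow> dir_deriv (\<lambda>y. dir_deriv f y c) x b"
    using cont[OF bc(2,1)] by fastforce
  show ?thesis
    using 1 2 by (simp only: eq) (rule LIMSEQ_unique)
qed

section \<open>Radial derivatives of spherical means and Darboux's equation\<close>

lemma continuous_on_Ck_comp:
  assumes "Ck_on k UNIV f" "continuous_on S a"
  shows "continuous_on S (\<lambda>w. f (a w))"
  by (rule continuous_on_compose2[OF Ck_on_imp_continuous_on[OF assms(1)] assms(2)]) auto

lemma continuous_on_dir_deriv:
  assumes f: "Ck_on (Suc k) UNIV f" and "continuous_on S a" "continuous_on S v"
  shows "continuous_on S (\<lambda>w. dir_deriv f (a w) (v w))"
  unfolding dir_deriv_eq_sum[OF f, of _ "v _"]
  by (intro continuous_intros continuous_on_Ck_comp[OF Ck_on_dir_deriv[OF f]] assms)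

lemma continuous_on_comp_fst:
  assumes "continuous_on A u"
  shows "continuous_on (A \<times> B) (\<lambda>p. u (fst p))"
  by (rule continuous_on_compose2[OF assms]) (auto intro!: continuous_intros)

lemma continuous_on_comp_snd:
  assumes "continuous_on B u"
  shows "continuous_on (A \<times> B) (\<lambda>p. u (snd p))"
  by (rule continuous_on_compose2[OF assms]) (auto intro!: continuous_intros)

text \<open>One rule for two uses: the direction v w = w gives radial derivatives, a constant
  direction v w = b gives spatial ones. The weight q takes the factors w_b that come from expanding
  a radial derivative in the basis.\<close>

lemma sphere_mean_line_derivative:
  fixes h :: "'a::euclidean_space \<Rightarrow> real"
  assumes h: "Ck_on (Suc k) UNIV h"
    and cont: "continuous_on (sphere 0 1) q" "continuous_on (sphere 0 1) a" "continuous_on (sphere 0 1) v"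
  shows "((\<lambda>s. sphere_mean (\<lambda>w. q w * h (a w + s *\<^sub>R v w))) has_real_derivative
    sphere_mean (\<lambda>w. q w * dir_deriv h (a w + s *\<^sub>R v w) (v w))) (at s)"
proof (rule has_real_derivative_sphere_mean)
  show "continuous_on (sphere 0 1) (\<lambda>w. q w * h (a w + s *\<^sub>R v w))" for s
    by (intro continuous_intros continuous_on_Ck_comp[OF h] cont)
  show "((\<lambda>s. q w * h (a w + s *\<^sub>R v w)) has_real_derivative q w * dir_deriv h (a w + s *\<^sub>R v w) (v w)) (at s)" for s w
    by (intro DERIV_cmult Ck_on_DERIV_line[OF h])
  show "continuous_on (UNIV \<times> sphere 0 1) (\<lambda>(s, w). q w * dir_deriv h (a w + s *\<^sub>R v w) (v w))"
    unfolding split_beta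
    by (intro continuous_intros continuous_on_dir_deriv[OF h] cont[THEN continuous_on_comp_snd])
qed auto

lemma sphere_mean_radial_derivative:
  assumes "Ck_on (Suc k) UNIV h"
  shows "((\<lambda>r. sphere_mean (\<lambda>w. h (x + r *\<^sub>R w))) has_real_derivative
    sphere_mean (\<lambda>w. dir_deriv h (x + r *\<^sub>R w) w)) (at r)"
  using sphere_mean_line_derivative[OF assms, of "\<lambda>w. 1" "\<lambda>w. x" "\<lambda>w. w" r]
  by (simp add: continuous_intros)

text \<open>The Hessian of h at y evaluated on (w, w). One slot is expanded in the basis because
  termwise differentiation of the expanded radial derivative yields this shape.\<close>

definition radial_second_deriv :: "('a::euclidean_space \<Rightarrow> real) \<Rightarrow> 'a \<Rightarrow> 'a \<Rightarrow> real" where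
  "radial_second_deriv h y w = (\<Sum>b\<in>Basis. (w \<bullet> b) * dir_deriv (\<lambda>z. dir_deriv h z b) y w)"

lemma sphere_mean_radial_second_derivative:
  assumes h: "Ck_on (Suc (Suc k)) UNIV h"
  shows "((\<lambda>r. sphere_mean (\<lambda>w. dir_deriv h (x + r *\<^sub>R w) w)) has_real_derivative
    sphere_mean (\<lambda>w. radial_second_deriv h (x + r *\<^sub>R w) w)) (at r)"
proof -
  note hb = Ck_on_dir_deriv[OF h]
  have "((\<lambda>r. \<Sum>b\<in>Basis. sphere_mean (\<lambda>w. (w \<bullet> b) * dir_deriv h (x + r *\<^sub>R w) b)) has_real_derivative
     (\<Sum>b\<in>Basis. sphere_mean (\<lambda>w. (w \<bullet> b) * dir_deriv (\<lambda>z. dir_deriv h z b) (x + r *\<^sub>R w) w))) (at r)"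
    by (intro DERIV_sum sphere_mean_line_derivative[OF hb, of _ _ "\<lambda>w. x" "\<lambda>w. w"] continuous_intros)
  also have "(\<lambda>r. \<Sum>b\<in>Basis. sphere_mean (\<lambda>w. (w \<bullet> b) * dir_deriv h (x + r *\<^sub>R w) b))
      = (\<lambda>r. sphere_mean (\<lambda>w. dir_deriv h (x + r *\<^sub>R w) w))"
    by (subst sphere_mean_sum[symmetric])
      (auto simp: dir_deriv_eq_sum[OF h, of _ "_ :: 'a", symmetric] intro!: continuous_intros continuous_on_Ck_comp[OF hb])
  also have "(\<Sum>b\<in>Basis. sphere_mean (\<lambda>w. (w \<bullet> b) * dir_deriv (\<lambda>z. dir_deriv h z b) (x + r *\<^sub>R w) w))
      = sphere_mean (\<lambda>w. radial_second_deriv h (x + r *\<^sub>R w) w)"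
    unfolding radial_second_deriv_def
    by (rule sphere_mean_sum[symmetric]) (intro continuous_intros continuous_on_dir_deriv[OF hb])
  finally show ?thesis .
qed

text \<open>The factor r is the chain rule factor of y \<mapsto> x + r y. Undivided, the equation
  also covers r = 0, where it says that a linear function has mean zero on the sphere.\<close>

lemma darboux_equation:
  fixes h :: "'a::euclidean_space \<Rightarrow> real"
  assumes h: "Ck_on (Suc (Suc k)) UNIV h"
  shows "r * sphere_mean (\<lambda>w. radial_second_deriv h (x + r *\<^sub>R w) w)
      + (real DIM('a) - 1) * sphere_mean (\<lambda>w. dir_deriv h (x + r *\<^sub>R w) w)
    = r * sphere_mean (\<lambda>w. laplacian h (x + r *\<^sub>R w))"
proof -
  note hb = Ck_on_dir_deriv[OF h]
  have *: "r * sphere_mean (\<lambda>w. dir_deriv (\<lambda>z. dir_deriv h z b) (x + r *\<^sub>R w) b)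
      = r * sphere_mean (\<lambda>w. (w \<bullet> b) * dir_deriv (\<lambda>z. dir_deriv h z b) (x + r *\<^sub>R w) w)
        + (real DIM('a) - 1) * sphere_mean (\<lambda>w. (w \<bullet> b) * dir_deriv h (x + r *\<^sub>R w) b)"
    if b: "b \<in> Basis" for b
  proof -
    have "((\<lambda>y. dir_deriv h (x + r *\<^sub>R y) b) has_derivative
        (\<lambda>v. dir_deriv (\<lambda>z. dir_deriv h z b) (x + r *\<^sub>R y) (r *\<^sub>R v))) (at y)" for y
      by (rule has_derivative_compose[OF _ Ck_on_has_derivative[OF hb[OF b]]])
        (auto intro!: derivative_eq_intros)
    from sphere_mean_tangential_divergence[OF b this] show ?thesis
      by (simp add: dir_deriv_scaleR[OF hb[OF b]] sphere_mean_cmult continuous_intros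
          continuous_on_dir_deriv[OF hb[OF b]] mult.left_commute[of _ r])
  qed
  have "r * sphere_mean (\<lambda>w. laplacian h (x + r *\<^sub>R w))
      = (\<Sum>b\<in>Basis. r * sphere_mean (\<lambda>w. dir_deriv (\<lambda>z. dir_deriv h z b) (x + r *\<^sub>R w) b))"
    unfolding laplacian_def
    by (subst sphere_mean_sum)
      (auto simp: sum_distrib_left intro!: continuous_intros continuous_on_dir_deriv[OF hb])
  also have "\<dots> = r * (\<Sum>b\<in>Basis. sphere_mean (\<lambda>w. (w \<bullet> b) * dir_deriv (\<lambda>z. dir_deriv h z b) (x + r *\<^sub>R w) w))
      + (real DIM('a) - 1) * (\<Sum>b\<in>Basis. sphere_mean (\<lambda>w. (w \<bullet> b) * dir_deriv h (x + r *\<^sub>R w) b))"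
    by (simp add: * sum.distrib sum_distrib_left)
  also have "(\<Sum>b\<in>Basis. sphere_mean (\<lambda>w. (w \<bullet> b) * dir_deriv (\<lambda>z. dir_deriv h z b) (x + r *\<^sub>R w) w))
      = sphere_mean (\<lambda>w. radial_second_deriv h (x + r *\<^sub>R w) w)"
    unfolding radial_second_deriv_def
    by (rule sphere_mean_sum[symmetric]) (intro continuous_intros continuous_on_dir_deriv[OF hb])
  also have "(\<Sum>b\<in>Basis. sphere_mean (\<lambda>w. (w \<bullet> b) * dir_deriv h (x + r *\<^sub>R w) b))
      = sphere_mean (\<lambda>w. dir_deriv h (x + r *\<^sub>R w) w)"
    by (subst sphere_mean_sum[symmetric])
      (auto simp: dir_deriv_eq_sum[OF h, of _ "_ :: 'a", symmetric] intro!: continuous_intros continuous_on_Ck_comp[OF hb])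
  finally show ?thesis by simp
qed

section \<open>The free solution\<close>

text \<open>Made for \<open>\<epsilon> * V + N\<close>. Agreement is asked on S only, since the
  integral equation prescribes u for nonnegative times only.\<close>

lemma has_second_deriv_within_linear_combination:
  assumes "has_second_deriv_within h D t S" "has_second_deriv_within k E t S"
    and "t \<in> S" "\<And>s. s \<in> S \<Longrightarrow> u s = c * h s + k s"
  shows "has_second_deriv_within u (c * D + E) t S"
proof -
  obtain h' k' where h': "\<forall>s\<in>S. (h has_real_derivative h' s) (at s within S)"
      "(h' has_real_derivative D) (at t within S)"
    and k': "\<forall>s\<in>S. (k has_real_derivative k' s) (at s within S)"
      "(k' has_real_derivative E) (at t within S)"
    using assms(1,2) by (auto simp: has_second_deriv_within_def)
  have "(u has_real_derivative c * h' s + k' s) (at s within S)" if s: "s \<in> S" for s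
  proof -
    have "((\<lambda>s. c * h s + k s) has_real_derivative c * h' s + k' s) (at s within S)"
      using h'(1) k'(1) s by (intro DERIV_add DERIV_cmult) auto
    then show ?thesis
      unfolding has_field_derivative_def
      by (rule has_derivative_transform[OF s, rotated]) (rule assms(4))
  qed
  moreover have "((\<lambda>s. c * h' s + k' s) has_real_derivative c * D + E) (at t within S)"
    using h'(2) k'(2) by (intro DERIV_add DERIV_cmult)
  ultimately show ?thesis
    unfolding has_second_deriv_within_def by (intro exI[of _ "\<lambda>s. c * h' s + k' s"]) auto
qed

lemma omega_n_DIM_pos: "omega_n DIM('a::euclidean_space) > 0"
  by (simp add: omega_n_pos)

lemma sphere_integral_eq_sphere_mean:
  "sphere_integral (h :: 'a::euclidean_space \<Rightarrow> real) = omega_n DIM('a) * sphere_mean h"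
  using omega_n_DIM_pos[where 'a='a] by (simp add: sphere_mean_def)

lemma V_term_eq:
  fixes f g :: "'a::euclidean_space \<Rightarrow> real"
  assumes f: "Ck_on (Suc k) UNIV f" and g: "Ck_on l UNIV g"
  shows "V_term f g x t = t * sphere_mean (\<lambda>w. dir_deriv f (x + t *\<^sub>R w) w) / (real DIM('a) - 2)
    + sphere_mean (\<lambda>w. f (x + t *\<^sub>R w)) + t * sphere_mean (\<lambda>w. g (x + t *\<^sub>R w))"
proof -
  have "V_term f g x t = sphere_mean (\<lambda>w. (t / (real DIM('a) - 2)) * dir_deriv f (x + t *\<^sub>R w) w
      + f (x + t *\<^sub>R w) + t * g (x + t *\<^sub>R w))"
    by (simp add: V_term_def sphere_mean_def)
  also have "\<dots> = (t / (real DIM('a) - 2)) * sphere_mean (\<lambda>w. dir_deriv f (x + t *\<^sub>R w) w)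
    + sphere_mean (\<lambda>w. f (x + t *\<^sub>R w)) + t * sphere_mean (\<lambda>w. g (x + t *\<^sub>R w))"
    by (simp add: sphere_mean_add sphere_mean_cmult continuous_intros continuous_on_dir_deriv[OF f]
        continuous_on_Ck_comp[OF f] continuous_on_Ck_comp[OF g] del: times_divide_eq_left)
  finally show ?thesis by simp
qed

lemma V_term_time_derivative:
  fixes f g :: "'a::euclidean_space \<Rightarrow> real"
  assumes f: "Ck_on (Suc (Suc k)) UNIV f" and g: "Ck_on (Suc l) UNIV g" and n: "DIM('a) \<ge> 3"
  shows "(V_term f g x has_real_derivative
    t * sphere_mean (\<lambda>w. laplacian f (x + t *\<^sub>R w)) / (real DIM('a) - 2)
    + sphere_mean (\<lambda>w. g (x + t *\<^sub>R w)) + t * sphere_mean (\<lambda>w. dir_deriv g (x + t *\<^sub>R w) w)) (at t)"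
proof -
  let ?n = "real DIM('a)"
  let ?P = "sphere_mean (\<lambda>w. dir_deriv f (x + t *\<^sub>R w) w)"
  let ?R = "sphere_mean (\<lambda>w. radial_second_deriv f (x + t *\<^sub>R w) w)"
  have n: "?n - 2 \<noteq> 0" using n by simp
  have "((\<lambda>t. V_term f g x t) has_real_derivative
      (?P + t * ?R) / (?n - 2) + ?P
      + (sphere_mean (\<lambda>w. g (x + t *\<^sub>R w)) + t * sphere_mean (\<lambda>w. dir_deriv g (x + t *\<^sub>R w) w))) (at t)"
    unfolding V_term_eq[OF f g]
    using n by (auto intro!: derivative_eq_intros sphere_mean_radial_derivative[OF f]
        sphere_mean_radial_derivative[OF g] sphere_mean_radial_second_derivative[OF f])
  \<comment> \<open>Since 1/(n - 2) + 1 = (n - 1)/(n - 2), the left side is Darboux's combination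
    divided by n - 2; this is the origin of the weight 1/(n - 2) in V.\<close>
  moreover have "(?P + t * ?R) / (?n - 2) + ?P = t * sphere_mean (\<lambda>w. laplacian f (x + t *\<^sub>R w)) / (?n - 2)"
    using n by (simp add: darboux_equation[OF f, symmetric] field_simps)
  ultimately show ?thesis by (simp add: add.assoc)
qed

lemma V_term_second_time_derivative:
  fixes f g :: "'a::euclidean_space \<Rightarrow> real"
  assumes f: "Ck_on 3 UNIV f" and g: "Ck_on 2 UNIV g" and n: "DIM('a) \<ge> 3" and "t \<in> S"
  shows "has_second_deriv_within (V_term f g x)
    ((sphere_mean (\<lambda>w. laplacian f (x + t *\<^sub>R w)) + t * sphere_mean (\<lambda>w. dir_deriv (laplacian f) (x + t *\<^sub>R w) w)) / (real DIM('a) - 2)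
    + 2 * sphere_mean (\<lambda>w. dir_deriv g (x + t *\<^sub>R w) w)
    + t * sphere_mean (\<lambda>w. radial_second_deriv g (x + t *\<^sub>R w) w)) t S"
proof -
  have f: "Ck_on (Suc (Suc (Suc 0))) UNIV f" using f by (simp add: numeral_3_eq_3)
  have g: "Ck_on (Suc (Suc 0)) UNIV g" using g by (simp add: numeral_2_eq_2)
  have n': "real DIM('a) - 2 \<noteq> 0" using n by simp
  \<comment> \<open>In this reduced form the next derivative meets third derivatives of f only as
    \<open>dir_deriv (laplacian f)\<close>, which is also how they appear in the Laplacian of
    V.\<close>
  let ?V' = "\<lambda>t. t * sphere_mean (\<lambda>w. laplacian f (x + t *\<^sub>R w)) / (real DIM('a) - 2)
    + sphere_mean (\<lambda>w. g (x + t *\<^sub>R w)) + t * sphere_mean (\<lambda>w. dir_deriv g (x + t *\<^sub>R w) w)"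
  have "(?V' has_real_derivative
    (sphere_mean (\<lambda>w. laplacian f (x + t *\<^sub>R w)) + t * sphere_mean (\<lambda>w. dir_deriv (laplacian f) (x + t *\<^sub>R w) w)) / (real DIM('a) - 2)
    + 2 * sphere_mean (\<lambda>w. dir_deriv g (x + t *\<^sub>R w) w)
    + t * sphere_mean (\<lambda>w. radial_second_deriv g (x + t *\<^sub>R w) w)) (at t)"
    using n' by (auto intro!: derivative_eq_intros sphere_mean_radial_derivative[OF Ck_on_laplacian[OF f]]
        sphere_mean_radial_derivative[OF g] sphere_mean_radial_second_derivative[OF g])
  with V_term_time_derivative[OF f g n, of x] show ?thesis
    unfolding has_second_deriv_within_def
    by (intro exI[of _ ?V']) (blast intro: has_field_derivative_at_within)
qed

section \<open>Spatial derivatives of the free solution\<close>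

text \<open>The variable x enters V as a translation, so a spatial derivative falls on the data.
  Only the radial term needs work: it is expanded in the basis, differentiated termwise and
  reassembled by symmetry of the mixed derivatives.\<close>

lemma V_term_space_derivative:
  fixes f g :: "'a::euclidean_space \<Rightarrow> real"
  assumes f: "Ck_on 2 UNIV f" and g: "Ck_on 1 UNIV g" and b: "b \<in> Basis"
  shows "((\<lambda>s. V_term f g (x + s *\<^sub>R b) t) has_real_derivative
    V_term (\<lambda>y. dir_deriv f y b) (\<lambda>y. dir_deriv g y b) (x + s *\<^sub>R b) t) (at s)"
proof -
  have f2: "Ck_on (Suc (Suc 0)) UNIV f" using f by (simp add: numeral_2_eq_2)
  have g1: "Ck_on (Suc 0) UNIV g" using g by simp
  note fb = Ck_on_dir_deriv[OF f2] and gb = Ck_on_dir_deriv[OF g1]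
  have mean: "((\<lambda>s. sphere_mean (\<lambda>w. q w * h (x + s *\<^sub>R b + t *\<^sub>R w))) has_real_derivative
     sphere_mean (\<lambda>w. q w * dir_deriv h (x + s *\<^sub>R b + t *\<^sub>R w) b)) (at s)"
    if "Ck_on (Suc k) UNIV h" "continuous_on (sphere 0 1) q" for h q k
    using sphere_mean_line_derivative[OF that(1,2), of "\<lambda>w. x + t *\<^sub>R w" "\<lambda>w. b" s]
    by (simp add: continuous_intros algebra_simps)
  have sum: "sphere_mean (\<lambda>w. dir_deriv h (y + t *\<^sub>R w) w)
      = (\<Sum>c\<in>Basis. sphere_mean (\<lambda>w. (w \<bullet> c) * dir_deriv h (y + t *\<^sub>R w) c))"
    if h: "Ck_on (Suc k) UNIV h" for h :: "'a \<Rightarrow> real" and k y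
    by (subst sphere_mean_sum[symmetric])
      (auto simp: dir_deriv_eq_sum[OF h, of _ "_ :: 'a", symmetric]
        intro!: continuous_intros continuous_on_Ck_comp[OF Ck_on_dir_deriv[OF h]])
  have "((\<lambda>s. sphere_mean (\<lambda>w. dir_deriv f (x + s *\<^sub>R b + t *\<^sub>R w) w)) has_real_derivative
     sphere_mean (\<lambda>w. dir_deriv (\<lambda>y. dir_deriv f y b) (x + s *\<^sub>R b + t *\<^sub>R w) w)) (at s)"
    unfolding sum[OF f2] sum[OF fb[OF b]] dir_deriv_commute[OF f b]
  proof (rule DERIV_sum)
    fix c :: 'a assume c: "c \<in> Basis"
    show "((\<lambda>s. sphere_mean (\<lambda>w. w \<bullet> c * dir_deriv f (x + s *\<^sub>R b + t *\<^sub>R w) c)) has_real_derivative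
      sphere_mean (\<lambda>w. w \<bullet> c * dir_deriv (\<lambda>y. dir_deriv f y b) (x + s *\<^sub>R b + t *\<^sub>R w) c)) (at s)"
      unfolding dir_deriv_commute[OF f b c]
      by (intro mean[OF fb[OF c]] continuous_intros)
  qed
  then have "((\<lambda>s. 1 / (real DIM('a) - 2) * (t * sphere_mean (\<lambda>w. dir_deriv f (x + s *\<^sub>R b + t *\<^sub>R w) w))
      + sphere_mean (\<lambda>w. f (x + s *\<^sub>R b + t *\<^sub>R w)) + t * sphere_mean (\<lambda>w. g (x + s *\<^sub>R b + t *\<^sub>R w))) has_real_derivative
      1 / (real DIM('a) - 2) * (t * sphere_mean (\<lambda>w. dir_deriv (\<lambda>y. dir_deriv f y b) (x + s *\<^sub>R b + t *\<^sub>R w) w))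
      + sphere_mean (\<lambda>w. dir_deriv f (x + s *\<^sub>R b + t *\<^sub>R w) b)
      + t * sphere_mean (\<lambda>w. dir_deriv g (x + s *\<^sub>R b + t *\<^sub>R w) b)) (at s)"
    using mean[OF f2, of "\<lambda>w. 1"] mean[OF g1, of "\<lambda>w. 1"]
    by (intro DERIV_add DERIV_cmult) auto
  then show ?thesis
    by (simp add: V_term_eq[OF f2 g1] V_term_eq[OF fb[OF b] gb[OF b]])
qed

lemma V_term_second_space_derivative:
  fixes f g :: "'a::euclidean_space \<Rightarrow> real"
  assumes f: "Ck_on 3 UNIV f" and g: "Ck_on 2 UNIV g" and b: "b \<in> Basis"
  shows "has_second_deriv_within (\<lambda>s. V_term f g (x + s *\<^sub>R b) t)
    (V_term (\<lambda>y. dir_deriv (\<lambda>z. dir_deriv f z b) y b) (\<lambda>y. dir_deriv (\<lambda>z. dir_deriv g z b) y b) x t) 0 UNIV"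
proof -
  have f3: "Ck_on (Suc (Suc (Suc 0))) UNIV f" using f by (simp add: numeral_3_eq_3)
  have g2: "Ck_on (Suc (Suc 0)) UNIV g" using g by (simp add: numeral_2_eq_2)
  have "((\<lambda>s. V_term f g (x + s *\<^sub>R b) t) has_real_derivative
    V_term (\<lambda>y. dir_deriv f y b) (\<lambda>y. dir_deriv g y b) (x + s *\<^sub>R b) t) (at s)" for s
    using Ck_on_SucD[OF f3] Ck_on_SucD[OF g2] b
    by (intro V_term_space_derivative) (auto simp: numeral_2_eq_2 simp del: Ck_on.simps)
  moreover have "((\<lambda>s. V_term (\<lambda>y. dir_deriv f y b) (\<lambda>y. dir_deriv g y b) (x + s *\<^sub>R b) t) has_real_derivative
    V_term (\<lambda>y. dir_deriv (\<lambda>z. dir_deriv f z b) y b) (\<lambda>y. dir_deriv (\<lambda>z. dir_deriv g z b) y b) (x + 0 *\<^sub>R b) t) (at 0)"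
    using Ck_on_dir_deriv[OF f3 b] Ck_on_dir_deriv[OF g2 b] b
    by (intro V_term_space_derivative) (auto simp: numeral_2_eq_2 simp del: Ck_on.simps)
  ultimately show ?thesis
    unfolding has_second_deriv_within_def
    by (intro exI[of _ "\<lambda>s. V_term (\<lambda>y. dir_deriv f y b) (\<lambda>y. dir_deriv g y b) (x + s *\<^sub>R b) t"]) auto
qed

lemma V_term_sum:
  fixes f g :: "'i \<Rightarrow> 'a::euclidean_space \<Rightarrow> real"
  assumes f: "\<And>i. i \<in> I \<Longrightarrow> Ck_on (Suc k) UNIV (f i)" and g: "\<And>i. i \<in> I \<Longrightarrow> Ck_on l UNIV (g i)"
  shows "(\<Sum>i\<in>I. V_term (f i) (g i) x t) = V_term (\<lambda>y. \<Sum>i\<in>I. f i y) (\<lambda>y. \<Sum>i\<in>I. g i y) x t"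
proof -
  have "sphere_mean (\<lambda>w. \<Sum>i\<in>I. dir_deriv (f i) (x + t *\<^sub>R w) w) = (\<Sum>i\<in>I. sphere_mean (\<lambda>w. dir_deriv (f i) (x + t *\<^sub>R w) w))"
    by (intro sphere_mean_sum continuous_on_dir_deriv[OF f] continuous_intros)
  moreover have "sphere_mean (\<lambda>w. \<Sum>i\<in>I. f i (x + t *\<^sub>R w)) = (\<Sum>i\<in>I. sphere_mean (\<lambda>w. f i (x + t *\<^sub>R w)))"
    by (intro sphere_mean_sum continuous_on_Ck_comp[OF f] continuous_intros)
  moreover have "sphere_mean (\<lambda>w. \<Sum>i\<in>I. g i (x + t *\<^sub>R w)) = (\<Sum>i\<in>I. sphere_mean (\<lambda>w. g i (x + t *\<^sub>R w)))"
    by (intro sphere_mean_sum continuous_on_Ck_comp[OF g] continuous_intros)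
  moreover have "(\<Sum>i\<in>I. V_term (f i) (g i) x t)
      = (\<Sum>i\<in>I. t * sphere_mean (\<lambda>w. dir_deriv (f i) (x + t *\<^sub>R w) w) / (real DIM('a) - 2)
         + sphere_mean (\<lambda>w. f i (x + t *\<^sub>R w)) + t * sphere_mean (\<lambda>w. g i (x + t *\<^sub>R w)))"
    by (intro sum.cong V_term_eq[OF f g] refl)
  ultimately show ?thesis
    by (simp add: V_term_eq[OF Ck_on_sum[OF f] Ck_on_sum[OF g]] dir_deriv_sum[OF f]
        sum.distrib sum_distrib_left sum_divide_distrib)
qed

lemma V_term_laplacian:
  fixes f g :: "'a::euclidean_space \<Rightarrow> real"
  assumes f: "Ck_on 3 UNIV f" and g: "Ck_on 2 UNIV g"
  shows "(\<Sum>b\<in>Basis. V_term (\<lambda>y. dir_deriv (\<lambda>z. dir_deriv f z b) y b) (\<lambda>y. dir_deriv (\<lambda>z. dir_deriv g z b) y b) x t)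
    = t * sphere_mean (\<lambda>w. dir_deriv (laplacian f) (x + t *\<^sub>R w) w) / (real DIM('a) - 2)
    + sphere_mean (\<lambda>w. laplacian f (x + t *\<^sub>R w)) + t * sphere_mean (\<lambda>w. laplacian g (x + t *\<^sub>R w))"
proof -
  have f3: "Ck_on (Suc (Suc (Suc 0))) UNIV f" using f by (simp add: numeral_3_eq_3)
  have g2: "Ck_on (Suc (Suc 0)) UNIV g" using g by (simp add: numeral_2_eq_2)
  have "(\<Sum>b\<in>Basis. V_term (\<lambda>y. dir_deriv (\<lambda>z. dir_deriv f z b) y b) (\<lambda>y. dir_deriv (\<lambda>z. dir_deriv g z b) y b) x t)
     = V_term (laplacian f) (laplacian g) x t"
    unfolding laplacian_def
    \<comment> \<open>Second derivatives of f keep one order of differentiability, which V uses up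
      on its first argument; those of g are merely continuous. This is where f in C3 and g in C2 are
      spent.\<close>
    by (intro V_term_sum[where k=0 and l=0] Ck_on_dir_deriv[OF Ck_on_dir_deriv[OF f3]] Ck_on_dir_deriv[OF Ck_on_dir_deriv[OF g2]])
  then show ?thesis
    by (simp add: V_term_eq[OF Ck_on_laplacian[OF f3] Ck_on_laplacian[OF g2]])
qed

section \<open>The Duhamel term\<close>

text \<open>Parameter and upper limit are first treated as independent variables: the Leibniz rule
  gives one partial derivative, the fundamental theorem the other, and continuity of the latter
  gives joint differentiability. Composition with the diagonal finishes. The parameter may run over
  all reals because a mean with negative radius t - tau still makes sense; only the upper limit is
  confined to \<open>{0..}\<close>.\<close>

lemma has_real_derivative_integral_upper_param:
  fixes K K' :: "real \<Rightarrow> real \<Rightarrow> real"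
  assumes deriv: "\<And>t \<tau>. \<tau> \<ge> 0 \<Longrightarrow> ((\<lambda>t. K t \<tau>) has_real_derivative K' t \<tau>) (at t)"
    and K: "continuous_on (UNIV \<times> {0..}) (\<lambda>(t, \<tau>). K t \<tau>)"
    and K': "continuous_on (UNIV \<times> {0..}) (\<lambda>(t, \<tau>). K' t \<tau>)"
    and "t \<ge> 0"
  shows "((\<lambda>t. integral {0..t} (K t)) has_real_derivative K t t + integral {0..t} (K' t)) (at t within {0..})"
proof -
  have slice: "continuous_on {0..a} (K t)" for t a
    by (rule continuous_on_subset[OF continuous_on_slice[OF K]]) auto
  have "((\<lambda>(t, a). integral {0..a} (K t)) has_derivative
      (\<lambda>(dt, da). integral {0..t} (K' t) * dt + blinfun_apply (blinfun_mult_right (K t t)) da))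
      (at (t, t) within UNIV \<times> {0..})"
  proof (rule has_derivative_partialsI[where fy = "\<lambda>s a. blinfun_mult_right (K s a)"])
    have "((\<lambda>s. integral (cbox 0 t) (K s)) has_real_derivative integral (cbox 0 t) (K' t)) (at t within UNIV)"
      by (rule leibniz_rule_field_derivative)
        (use deriv slice in \<open>auto intro!: integrable_continuous_real continuous_on_subset[OF K']\<close>)
    then show "((\<lambda>s. integral {0..t} (K s)) has_derivative (\<lambda>dt. integral {0..t} (K' t) * dt)) (at t within UNIV)"
      by (simp add: has_field_derivative_def)
    fix s a :: real assume a: "a \<in> {0..}"
    have "((\<lambda>a. integral {0..a} (K s)) has_real_derivative K s a) (at a within {0..a + 1})"
      using a by (intro integral_has_real_derivative slice) auto
    \<comment> \<open>The fundamental theorem was applied on a compact interval; near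
      \<open>a\<close> it coincides with \<open>{0..}\<close>.\<close>
    then have "((\<lambda>a. integral {0..a} (K s)) has_real_derivative K s a) (at a within {0..})"
      using a at_within_nhd[of a "{a - 1<..<a + 1}" "{0..a + 1}" "{0..}"] by force
    then show "((\<lambda>a. integral {0..a} (K s)) has_derivative blinfun_apply (blinfun_mult_right (K s a))) (at a within {0..})"
      by (simp add: has_field_derivative_def)
  next
    have "continuous_on (UNIV \<times> {0..}) (\<lambda>(s, a). blinfun_mult_right (K s a))"
      using bounded_linear.continuous_on[OF bounded_linear_blinfun_mult_right K]
      by (simp add: split_beta)
    then show "continuous (at (t, t) within UNIV \<times> {0..}) (\<lambda>(s, a). blinfun_mult_right (K s a))"
      using \<open>t \<ge> 0\<close> by (auto simp: continuous_on_eq_continuous_within)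
  qed (use \<open>t \<ge> 0\<close> in auto)
  moreover have "(\<lambda>s. (s, s)) ` {0..} \<subseteq> UNIV \<times> {0::real..}" by auto
  ultimately have D: "((\<lambda>(t, a). integral {0..a} (K t)) has_derivative
      (\<lambda>(dt, da). integral {0..t} (K' t) * dt + blinfun_apply (blinfun_mult_right (K t t)) da))
      (at (t, t) within (\<lambda>s. (s, s)) ` {0..})"
    by (rule has_derivative_subset)
  have "((\<lambda>s. (s, s)) has_derivative (\<lambda>h. (h, h))) (at t within {0..})"
    by (auto intro!: derivative_eq_intros)
  from has_derivative_in_compose[OF this D] show ?thesis
    unfolding has_field_derivative_def split
    by (rule has_derivative_eq_rhs) (simp add: fun_eq_iff distrib_right add.commute)
qed

section \<open>Ck functions on the half-space and their time slices\<close>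

lemma Ck_on_cong:
  assumes "Ck_on k S f" "\<And>x. x \<in> S \<Longrightarrow> g x = f x"
  shows "Ck_on k S g"
proof (cases k)
  case 0
  then show ?thesis using assms by (simp cong: continuous_on_cong)
next
  case (Suc m)
  then obtain Df where "\<And>x. x \<in> S \<Longrightarrow> (f has_derivative Df x) (at x within S)"
      "\<And>b. b \<in> Basis \<Longrightarrow> Ck_on m S (\<lambda>x. Df x b)"
    using assms(1) by (simp only: Ck_on.simps) blast
  moreover from this(1) have "(g has_derivative Df x) (at x within S)" if "x \<in> S" for x
    by (rule has_derivative_transform[OF that, rotated]) (use that assms(2) in auto)
  ultimately show ?thesis unfolding Suc Ck_on.simps by blast
qed

text \<open>A slice moves inside the half-space, so the derivative of F within it restricts to a
  full derivative on R^n, also at time 0. All results on spherical means thus apply to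
  slices.\<close>

lemma Ck_on_time_slice:
  fixes F :: "'a::euclidean_space \<times> real \<Rightarrow> real"
  assumes "Ck_on k (UNIV \<times> {0..}) F" "\<tau> \<ge> 0"
  shows "Ck_on k UNIV (\<lambda>y. F (y, \<tau>))"
  using assms(1)
proof (induction k arbitrary: F)
  case 0
  then have "continuous_on (UNIV \<times> {0..}) F" by simp
  then show ?case
    using assms(2) by (auto intro!: continuous_on_compose2[of "UNIV \<times> {0..}" F] continuous_intros)
next
  case (Suc k)
  from Suc.prems obtain DF where DF: "\<And>z. z \<in> UNIV \<times> {0..} \<Longrightarrow> (F has_derivative DF z) (at z within UNIV \<times> {0..})"
    "\<And>b. b \<in> Basis \<Longrightarrow> Ck_on k (UNIV \<times> {0..}) (\<lambda>z. DF z b)"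
    by (simp only: Ck_on.simps) blast
  have "((\<lambda>y. F (y, \<tau>)) has_derivative (\<lambda>v. DF (y, \<tau>) (v, 0))) (at y)" for y
    by (rule has_derivative_in_compose2[OF DF(1), where s=UNIV])
      (use assms(2) in \<open>auto intro!: derivative_eq_intros\<close>)
  moreover have "Ck_on k UNIV (\<lambda>y. DF (y, \<tau>) (b, 0))" if "b \<in> Basis" for b
    using that by (intro Suc.IH DF(2)) (auto simp: Basis_prod_def)
  ultimately show ?case by (auto intro!: exI[of _ "\<lambda>y v. DF (y, \<tau>) (v, 0)"])
qed

text \<open>At time 0 \<open>dir_deriv\<close> of F itself would involve values at negative times.
  The spatial part is therefore expressed by slices, and the time part is the value of the
  derivative on (0, 1).\<close>

lemma Ck_on_time_slice_deriv:
  fixes F :: "'a::euclidean_space \<times> real \<Rightarrow> real"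
  assumes F: "Ck_on (Suc k) (UNIV \<times> {0..}) F"
  obtains Ft where "Ck_on k (UNIV \<times> {0..}) Ft"
    and "\<And>y \<tau>. \<tau> \<ge> 0 \<Longrightarrow> (F has_derivative (\<lambda>(v, s). dir_deriv (\<lambda>z. F (z, \<tau>)) y v + s * Ft (y, \<tau>)))
      (at (y, \<tau>) within UNIV \<times> {0..})"
    and "\<And>b. b \<in> Basis \<Longrightarrow> Ck_on k (UNIV \<times> {0..}) (\<lambda>(y, \<tau>). dir_deriv (\<lambda>z. F (z, \<tau>)) y b)"
proof -
  from F obtain DF where DF: "\<And>z. z \<in> UNIV \<times> {0..} \<Longrightarrow> (F has_derivative DF z) (at z within UNIV \<times> {0..})"
    "\<And>b. b \<in> Basis \<Longrightarrow> Ck_on k (UNIV \<times> {0..}) (\<lambda>z. DF z b)"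
    by (simp only: Ck_on.simps) blast
  have slice: "dir_deriv (\<lambda>z. F (z, \<tau>)) y = (\<lambda>v. DF (y, \<tau>) (v, 0))" if "\<tau> \<ge> 0" for y \<tau>
    by (intro dir_deriv_eqI has_derivative_in_compose2[OF DF(1), where s=UNIV])
      (use that in \<open>auto intro!: derivative_eq_intros\<close>)
  show ?thesis
  proof
    show "Ck_on k (UNIV \<times> {0..}) (\<lambda>z. DF z (0, 1))"
      by (intro DF(2)) (auto simp: Basis_prod_def)
    show "Ck_on k (UNIV \<times> {0..}) (\<lambda>(y, \<tau>). dir_deriv (\<lambda>z. F (z, \<tau>)) y b)" if "b \<in> Basis" for b
      using that slice by (intro Ck_on_cong[OF DF(2), of "(b, 0)"]) (auto simp: Basis_prod_def)
    fix y :: 'a and \<tau> :: real assume \<tau>: "\<tau> \<ge> 0"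
    then have D: "(F has_derivative DF (y, \<tau>)) (at (y, \<tau>) within UNIV \<times> {0..})"
      using DF(1) by auto
    have lin: "linear (DF (y, \<tau>))" using D by (rule has_derivative_linear)
    have eq: "DF (y, \<tau>) (v, s) = DF (y, \<tau>) (v, 0) + s * DF (y, \<tau>) (0, 1)" for v s
      using linear_add[OF lin, of "(v, 0)" "s *\<^sub>R (0, 1)"] linear_cmul[OF lin, of s "(0, 1)"] by simp
    have "DF (y, \<tau>) = (\<lambda>(v, s). dir_deriv (\<lambda>z. F (z, \<tau>)) y v + s * DF (y, \<tau>) (0, 1))"
    proof
      show "DF (y, \<tau>) p = (case p of (v, s) \<Rightarrow> dir_deriv (\<lambda>z. F (z, \<tau>)) y v + s * DF (y, \<tau>) (0, 1))" for p
        by (cases p) (simp only: slice[OF \<tau>] split, rule eq)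
    qed
    from has_derivative_eq_rhs[OF D this] show "(F has_derivative (\<lambda>(v, s). dir_deriv (\<lambda>z. F (z, \<tau>)) y v + s * DF (y, \<tau>) (0, 1)))
      (at (y, \<tau>) within UNIV \<times> {0..})" .
  qed
qed

lemma Ck_on_space_deriv:
  fixes F :: "'a::euclidean_space \<times> real \<Rightarrow> real"
  assumes "Ck_on (Suc k) (UNIV \<times> {0..}) F" "b \<in> Basis"
  shows "Ck_on k (UNIV \<times> {0..}) (\<lambda>(y, \<tau>). dir_deriv (\<lambda>z. F (z, \<tau>)) y b)"
  using assms Ck_on_time_slice_deriv by blast

text \<open>Centre, radius and time may all depend on the parameter; the argument w of G admits
  radial derivatives as integrands.\<close>

lemma continuous_on_sphere_mean_moving:
  fixes G :: "'a::euclidean_space \<Rightarrow> real \<Rightarrow> 'a \<Rightarrow> real" and a :: "'p::topological_space \<Rightarrow> 'a"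
  assumes G: "continuous_on ((UNIV \<times> {0..}) \<times> UNIV) (\<lambda>((y, \<tau>), w). G y \<tau> w)"
    and cont: "continuous_on U a" "continuous_on U r" "continuous_on U \<tau>"
    and nonneg: "\<And>p. p \<in> U \<Longrightarrow> \<tau> p \<ge> 0"
  shows "continuous_on U (\<lambda>p. sphere_mean (\<lambda>w. G (a p + r p *\<^sub>R w) (\<tau> p) w))"
proof (rule continuous_on_sphere_mean)
  have fst: "continuous_on (U \<times> sphere (0::'a) 1) (\<lambda>x. a (fst x))" "continuous_on (U \<times> sphere (0::'a) 1) (\<lambda>x. r (fst x))"
    "continuous_on (U \<times> sphere (0::'a) 1) (\<lambda>x. \<tau> (fst x))"
    by (auto intro!: continuous_on_compose2[OF cont(1)] continuous_on_compose2[OF cont(2)]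
        continuous_on_compose2[OF cont(3)] continuous_on_fst)
  have "continuous_on (U \<times> sphere 0 1) (\<lambda>x. ((a (fst x) + r (fst x) *\<^sub>R snd x, \<tau> (fst x)), snd x))"
    by (intro continuous_intros fst)
  from continuous_on_compose2[OF G this]
  have "continuous_on (U \<times> sphere 0 1) (\<lambda>x. G (a (fst x) + r (fst x) *\<^sub>R snd x) (\<tau> (fst x)) (snd x))"
    using nonneg by (simp add: image_subset_iff)
  then show "continuous_on (U \<times> sphere 0 1) (\<lambda>(p, w). G (a p + r p *\<^sub>R w) (\<tau> p) w)"
    by (simp add: split_beta)
qed

lemma continuous_on_integrand:
  fixes F :: "'a::euclidean_space \<times> real \<Rightarrow> real"
  assumes "Ck_on k (UNIV \<times> {0..}) F"
  shows "continuous_on ((UNIV \<times> {0..}) \<times> UNIV) (\<lambda>((y, \<tau>), w::'a). F (y, \<tau>))"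
  using continuous_on_comp_fst[OF Ck_on_imp_continuous_on[OF assms]] by (simp add: split_beta)

lemma continuous_on_integrand_radial:
  fixes F :: "'a::euclidean_space \<times> real \<Rightarrow> real"
  assumes F: "Ck_on (Suc k) (UNIV \<times> {0..}) F"
  shows "continuous_on ((UNIV \<times> {0..}) \<times> UNIV) (\<lambda>((y, \<tau>), w). dir_deriv (\<lambda>z. F (z, \<tau>)) y w)"
proof -
  have "continuous_on ((UNIV \<times> {0..}) \<times> UNIV)
      (\<lambda>p. \<Sum>b\<in>Basis. (snd p \<bullet> b) * (\<lambda>(y, \<tau>). dir_deriv (\<lambda>z. F (z, \<tau>)) y b) (fst p))"
    by (intro continuous_intros continuous_on_comp_fst Ck_on_imp_continuous_on[OF Ck_on_space_deriv[OF F]])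
  then show ?thesis
    by (rule continuous_on_eq)
      (auto simp: dir_deriv_eq_sum[OF Ck_on_time_slice[OF F], symmetric])
qed

lemma continuous_on_integrand_radial_second:
  fixes F :: "'a::euclidean_space \<times> real \<Rightarrow> real"
  assumes F: "Ck_on (Suc (Suc k)) (UNIV \<times> {0..}) F"
  shows "continuous_on ((UNIV \<times> {0..}) \<times> UNIV) (\<lambda>((y, \<tau>), w). radial_second_deriv (\<lambda>z. F (z, \<tau>)) y w)"
proof -
  note Fb = Ck_on_space_deriv[OF F]
  have "continuous_on ((UNIV \<times> {0..}) \<times> UNIV)
      (\<lambda>p. \<Sum>b\<in>Basis. (snd p \<bullet> b) * (\<Sum>c\<in>Basis. (snd p \<bullet> c) *
        (\<lambda>(y, \<tau>). dir_deriv (\<lambda>z. dir_deriv (\<lambda>z. F (z, \<tau>)) z b) y c) (fst p)))"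
    using Ck_on_imp_continuous_on[OF Ck_on_space_deriv[OF Fb]]
    by (intro continuous_intros continuous_on_comp_fst) simp
  then show ?thesis
    unfolding radial_second_deriv_def
    by (rule continuous_on_eq)
      (auto simp: dir_deriv_eq_sum[OF Ck_on_dir_deriv[OF Ck_on_time_slice[OF F]], symmetric] intro!: sum.cong)
qed

section \<open>Derivatives of the Duhamel term\<close>

lemma N_term_eq:
  fixes F :: "'a::euclidean_space \<times> real \<Rightarrow> real"
  shows "N_term F x t = 1 / (real DIM('a) - 2) *
    integral {0..t} (\<lambda>\<tau>. (t - \<tau>) * sphere_mean (\<lambda>w. F (x + (t - \<tau>) *\<^sub>R w, \<tau>)))"
proof -
  have "integral {0..t} (\<lambda>\<tau>. (t - \<tau>) * sphere_integral (\<lambda>w. F (x + (t - \<tau>) *\<^sub>R w, \<tau>)))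
      = omega_n DIM('a) * integral {0..t} (\<lambda>\<tau>. (t - \<tau>) * sphere_mean (\<lambda>w. F (x + (t - \<tau>) *\<^sub>R w, \<tau>)))"
    by (subst integral_mult_right[symmetric]) (simp add: sphere_integral_eq_sphere_mean mult.left_commute)
  then show ?thesis
    using omega_n_DIM_pos[where 'a='a] by (simp add: N_term_def)
qed

lemma continuous_on_N_integrand:
  fixes G :: "'a::euclidean_space \<Rightarrow> real \<Rightarrow> 'a \<Rightarrow> real"
  assumes "continuous_on ((UNIV \<times> {0..}) \<times> UNIV) (\<lambda>((y, \<tau>), w). G y \<tau> w)"
  shows "continuous_on (UNIV \<times> {0..}) (\<lambda>(t, \<tau>). sphere_mean (\<lambda>w. G (x + (t - \<tau>) *\<^sub>R w) \<tau> w))"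
  unfolding split_beta
  by (rule continuous_on_sphere_mean_moving[OF assms]) (auto intro!: continuous_intros)

lemma continuous_on_N_integrand_slice:
  fixes G :: "'a::euclidean_space \<Rightarrow> real \<Rightarrow> 'a \<Rightarrow> real"
  assumes "continuous_on ((UNIV \<times> {0..}) \<times> UNIV) (\<lambda>((y, \<tau>), w). G y \<tau> w)"
  shows "continuous_on {0..t} (\<lambda>\<tau>. sphere_mean (\<lambda>w. G (x + (t - \<tau>) *\<^sub>R w) \<tau> w))"
  by (rule continuous_on_sphere_mean_moving[OF assms]) (auto intro!: continuous_intros)

lemma DERIV_shift_minus:
  "(\<And>r. (f has_real_derivative f' r) (at r)) \<Longrightarrow> ((\<lambda>t. f (t - c)) has_real_derivative f' (t - c)) (at t)"
  using DERIV_shift[of f "f' (t - c)" t "- c"] by simp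

lemma N_term_time_derivative:
  fixes F :: "'a::euclidean_space \<times> real \<Rightarrow> real"
  assumes F: "Ck_on (Suc k) (UNIV \<times> {0..}) F" and "t \<ge> 0"
  shows "(N_term F x has_real_derivative 1 / (real DIM('a) - 2) * integral {0..t} (\<lambda>\<tau>.
      sphere_mean (\<lambda>w. F (x + (t - \<tau>) *\<^sub>R w, \<tau>))
      + (t - \<tau>) * sphere_mean (\<lambda>w. dir_deriv (\<lambda>z. F (z, \<tau>)) (x + (t - \<tau>) *\<^sub>R w) w))) (at t within {0..})"
proof -
  let ?P = "\<lambda>t \<tau>. sphere_mean (\<lambda>w. F (x + (t - \<tau>) *\<^sub>R w, \<tau>))"
  let ?Q = "\<lambda>t \<tau>. sphere_mean (\<lambda>w. dir_deriv (\<lambda>z. F (z, \<tau>)) (x + (t - \<tau>) *\<^sub>R w) w)"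
  note P = continuous_on_N_integrand[OF continuous_on_integrand[OF F], unfolded split_beta]
  note Q = continuous_on_N_integrand[OF continuous_on_integrand_radial[OF F], unfolded split_beta]
  \<comment> \<open>The boundary contribution at tau = t carries the weight t - t and drops
    out.\<close>
  have "((\<lambda>t. integral {0..t} (\<lambda>\<tau>. (t - \<tau>) * ?P t \<tau>)) has_real_derivative
      (t - t) * ?P t t + integral {0..t} (\<lambda>\<tau>. ?P t \<tau> + (t - \<tau>) * ?Q t \<tau>)) (at t within {0..})"
  proof (rule has_real_derivative_integral_upper_param)
    fix t \<tau> :: real assume \<tau>: "\<tau> \<ge> 0"
    have "((\<lambda>t. ?P t \<tau>) has_real_derivative ?Q t \<tau>) (at t)"
      by (rule DERIV_shift_minus[OF sphere_mean_radial_derivative[OF Ck_on_time_slice[OF F \<tau>]]])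
    then show "((\<lambda>t. (t - \<tau>) * ?P t \<tau>) has_real_derivative ?P t \<tau> + (t - \<tau>) * ?Q t \<tau>) (at t)"
      by (auto intro!: derivative_eq_intros)
  qed (use \<open>t \<ge> 0\<close> in \<open>auto simp: split_beta intro!: continuous_intros P Q\<close>)
  then show ?thesis
    unfolding N_term_eq by (intro DERIV_cmult) simp
qed

lemma N_term_second_time_derivative:
  fixes F :: "'a::euclidean_space \<times> real \<Rightarrow> real"
  assumes F: "Ck_on (Suc (Suc k)) (UNIV \<times> {0..}) F" and "t \<ge> 0"
  shows "has_second_deriv_within (N_term F x) (1 / (real DIM('a) - 2) * (F (x, t) + integral {0..t} (\<lambda>\<tau>.
      2 * sphere_mean (\<lambda>w. dir_deriv (\<lambda>z. F (z, \<tau>)) (x + (t - \<tau>) *\<^sub>R w) w)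
      + (t - \<tau>) * sphere_mean (\<lambda>w. radial_second_deriv (\<lambda>z. F (z, \<tau>)) (x + (t - \<tau>) *\<^sub>R w) w)))) t {0..}"
proof -
  let ?P = "\<lambda>t \<tau>. sphere_mean (\<lambda>w. F (x + (t - \<tau>) *\<^sub>R w, \<tau>))"
  let ?Q = "\<lambda>t \<tau>. sphere_mean (\<lambda>w. dir_deriv (\<lambda>z. F (z, \<tau>)) (x + (t - \<tau>) *\<^sub>R w) w)"
  let ?R = "\<lambda>t \<tau>. sphere_mean (\<lambda>w. radial_second_deriv (\<lambda>z. F (z, \<tau>)) (x + (t - \<tau>) *\<^sub>R w) w)"
  note P = continuous_on_N_integrand[OF continuous_on_integrand[OF F], unfolded split_beta]
  note Q = continuous_on_N_integrand[OF continuous_on_integrand_radial[OF F], unfolded split_beta]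
  note R = continuous_on_N_integrand[OF continuous_on_integrand_radial_second[OF F], unfolded split_beta]
  \<comment> \<open>Now the boundary contribution survives: the sphere of radius 0 gives
    \<open>?P t t = F (x, t)\<close>, the source of the wave equation.\<close>
  have "((\<lambda>t. integral {0..t} (\<lambda>\<tau>. ?P t \<tau> + (t - \<tau>) * ?Q t \<tau>)) has_real_derivative
      (?P t t + (t - t) * ?Q t t) + integral {0..t} (\<lambda>\<tau>. 2 * ?Q t \<tau> + (t - \<tau>) * ?R t \<tau>)) (at t within {0..})"
  proof (rule has_real_derivative_integral_upper_param)
    fix t \<tau> :: real assume \<tau>: "\<tau> \<ge> 0"
    note slice = Ck_on_time_slice[OF F \<tau>]
    have "((\<lambda>t. ?P t \<tau>) has_real_derivative ?Q t \<tau>) (at t)"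
      by (rule DERIV_shift_minus[OF sphere_mean_radial_derivative[OF slice]])
    moreover have "((\<lambda>t. ?Q t \<tau>) has_real_derivative ?R t \<tau>) (at t)"
      by (rule DERIV_shift_minus[OF sphere_mean_radial_second_derivative[OF slice]])
    ultimately show "((\<lambda>t. ?P t \<tau> + (t - \<tau>) * ?Q t \<tau>) has_real_derivative 2 * ?Q t \<tau> + (t - \<tau>) * ?R t \<tau>) (at t)"
      by (auto intro!: derivative_eq_intros)
  qed (use \<open>t \<ge> 0\<close> in \<open>auto simp: split_beta intro!: continuous_intros P Q R\<close>)
  then have "((\<lambda>t. 1 / (real DIM('a) - 2) * integral {0..t} (\<lambda>\<tau>. ?P t \<tau> + (t - \<tau>) * ?Q t \<tau>)) has_real_derivative
      1 / (real DIM('a) - 2) * (F (x, t) + integral {0..t} (\<lambda>\<tau>. 2 * ?Q t \<tau> + (t - \<tau>) * ?R t \<tau>))) (at t within {0..})"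
    by (intro DERIV_cmult) simp
  with N_term_time_derivative[OF F, of _ x] show ?thesis
    unfolding has_second_deriv_within_def
    by (intro exI[of _ "\<lambda>t. 1 / (real DIM('a) - 2) * integral {0..t} (\<lambda>\<tau>. ?P t \<tau> + (t - \<tau>) * ?Q t \<tau>)"]) auto
qed

lemma N_term_space_derivative:
  fixes F :: "'a::euclidean_space \<times> real \<Rightarrow> real"
  assumes F: "Ck_on (Suc k) (UNIV \<times> {0..}) F" and b: "b \<in> Basis"
  shows "((\<lambda>s. N_term F (x + s *\<^sub>R b) t) has_real_derivative
    N_term (\<lambda>(y, \<tau>). dir_deriv (\<lambda>z. F (z, \<tau>)) y b) (x + s *\<^sub>R b) t) (at s)"
proof -
  let ?P = "\<lambda>s \<tau>. sphere_mean (\<lambda>w. F (x + s *\<^sub>R b + (t - \<tau>) *\<^sub>R w, \<tau>))"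
  let ?P' = "\<lambda>s \<tau>. sphere_mean (\<lambda>w. dir_deriv (\<lambda>z. F (z, \<tau>)) (x + s *\<^sub>R b + (t - \<tau>) *\<^sub>R w) b)"
  have "((\<lambda>s. integral (cbox 0 t) (\<lambda>\<tau>. (t - \<tau>) * ?P s \<tau>)) has_real_derivative
      integral (cbox 0 t) (\<lambda>\<tau>. (t - \<tau>) * ?P' s \<tau>)) (at s within UNIV)"
  proof (rule leibniz_rule_field_derivative)
    fix s \<tau> :: real assume "\<tau> \<in> cbox 0 t"
    then have "\<tau> \<ge> 0" by simp
    from sphere_mean_line_derivative[OF Ck_on_time_slice[OF F this], of "\<lambda>w. 1" "\<lambda>w. x + (t - \<tau>) *\<^sub>R w" "\<lambda>w. b" s]
    have "((\<lambda>s. ?P s \<tau>) has_real_derivative ?P' s \<tau>) (at s)"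
      by (simp add: continuous_intros algebra_simps)
    then show "((\<lambda>s. (t - \<tau>) * ?P s \<tau>) has_real_derivative (t - \<tau>) * ?P' s \<tau>) (at s within UNIV)"
      by (rule DERIV_cmult)
  next
    fix s
    show "(\<lambda>\<tau>. (t - \<tau>) * ?P s \<tau>) integrable_on cbox 0 t"
      unfolding cbox_interval
      by (intro integrable_continuous_real continuous_intros
          continuous_on_N_integrand_slice[OF continuous_on_integrand[OF F]])
  next
    have "continuous_on ((UNIV \<times> {0..}) \<times> UNIV) (\<lambda>((y, \<tau>), w::'a). dir_deriv (\<lambda>z. F (z, \<tau>)) y b)"
      using continuous_on_comp_fst[OF Ck_on_imp_continuous_on[OF Ck_on_space_deriv[OF F b]]]
      by (simp add: split_beta)
    then have "continuous_on (UNIV \<times> cbox 0 t) (\<lambda>p. ?P' (fst p) (snd p))"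
      by (rule continuous_on_sphere_mean_moving) (auto intro!: continuous_intros)
    then show "continuous_on (UNIV \<times> cbox 0 t) (\<lambda>(s, \<tau>). (t - \<tau>) * ?P' s \<tau>)"
      unfolding split_beta by (intro continuous_intros)
  qed auto
  then show ?thesis
    unfolding N_term_eq cbox_interval split by (rule DERIV_cmult)
qed

lemma N_term_second_space_derivative:
  fixes F :: "'a::euclidean_space \<times> real \<Rightarrow> real"
  assumes F: "Ck_on (Suc (Suc k)) (UNIV \<times> {0..}) F" and b: "b \<in> Basis"
  shows "has_second_deriv_within (\<lambda>s. N_term F (x + s *\<^sub>R b) t)
    (N_term (\<lambda>(y, \<tau>). dir_deriv (\<lambda>z. dir_deriv (\<lambda>z. F (z, \<tau>)) z b) y b) x t) 0 UNIV"
  using N_term_space_derivative[OF F b] N_term_space_derivative[OF Ck_on_space_deriv[OF F b] b, of x t 0]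
  unfolding has_second_deriv_within_def
  by (intro exI[of _ "\<lambda>s. N_term (\<lambda>(y, \<tau>). dir_deriv (\<lambda>z. F (z, \<tau>)) y b) (x + s *\<^sub>R b) t"]) auto

text \<open>Darboux's equation with r = t - tau under the integral, the weight of N(F) being its
  factor r. Laplacian and second time derivative then share the same second-order radial
  term.\<close>

lemma N_term_laplacian:
  fixes F :: "'a::euclidean_space \<times> real \<Rightarrow> real"
  assumes F: "Ck_on (Suc (Suc k)) (UNIV \<times> {0..}) F"
  shows "(\<Sum>b\<in>Basis. N_term (\<lambda>(y, \<tau>). dir_deriv (\<lambda>z. dir_deriv (\<lambda>z. F (z, \<tau>)) z b) y b) x t)
    = 1 / (real DIM('a) - 2) * integral {0..t} (\<lambda>\<tau>.
      (t - \<tau>) * sphere_mean (\<lambda>w. radial_second_deriv (\<lambda>z. F (z, \<tau>)) (x + (t - \<tau>) *\<^sub>R w) w)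
      + (real DIM('a) - 1) * sphere_mean (\<lambda>w. dir_deriv (\<lambda>z. F (z, \<tau>)) (x + (t - \<tau>) *\<^sub>R w) w))"
proof -
  let ?L = "\<lambda>b \<tau>. sphere_mean (\<lambda>w. dir_deriv (\<lambda>z. dir_deriv (\<lambda>z. F (z, \<tau>)) z b) (x + (t - \<tau>) *\<^sub>R w) b)"
  have cont: "continuous_on {0..t} (?L b)" if b: "b \<in> Basis" for b
  proof (rule continuous_on_N_integrand_slice)
    show "continuous_on ((UNIV \<times> {0..}) \<times> UNIV) (\<lambda>((y, \<tau>), w::'a). dir_deriv (\<lambda>z. dir_deriv (\<lambda>z. F (z, \<tau>)) z b) y b)"
      using continuous_on_comp_fst[OF Ck_on_imp_continuous_on[OF Ck_on_space_deriv[OF Ck_on_space_deriv[OF F b] b]]]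
      by (simp add: split_beta)
  qed
  have "(\<Sum>b\<in>Basis. integral {0..t} (\<lambda>\<tau>. (t - \<tau>) * ?L b \<tau>)) = integral {0..t} (\<lambda>\<tau>. \<Sum>b\<in>Basis. (t - \<tau>) * ?L b \<tau>)"
    by (rule integral_sum[symmetric])
      (auto intro!: integrable_continuous_real continuous_intros cont)
  also have "\<dots> = integral {0..t} (\<lambda>\<tau>.
      (t - \<tau>) * sphere_mean (\<lambda>w. radial_second_deriv (\<lambda>z. F (z, \<tau>)) (x + (t - \<tau>) *\<^sub>R w) w)
      + (real DIM('a) - 1) * sphere_mean (\<lambda>w. dir_deriv (\<lambda>z. F (z, \<tau>)) (x + (t - \<tau>) *\<^sub>R w) w))"
  proof (rule Henstock_Kurzweil_Integration.integral_cong)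
    fix \<tau> assume "\<tau> \<in> {0..t}"
    then have slice: "Ck_on (Suc (Suc k)) UNIV (\<lambda>z. F (z, \<tau>))"
      using Ck_on_time_slice[OF F] by simp
    have "(\<Sum>b\<in>Basis. ?L b \<tau>) = sphere_mean (\<lambda>w. laplacian (\<lambda>z. F (z, \<tau>)) (x + (t - \<tau>) *\<^sub>R w))"
      unfolding laplacian_def
      by (intro sphere_mean_sum[symmetric] continuous_on_dir_deriv[OF Ck_on_dir_deriv[OF slice]] continuous_intros)
    then show "(\<Sum>b\<in>Basis. (t - \<tau>) * ?L b \<tau>) = (t - \<tau>) * sphere_mean (\<lambda>w. radial_second_deriv (\<lambda>z. F (z, \<tau>)) (x + (t - \<tau>) *\<^sub>R w) w)
      + (real DIM('a) - 1) * sphere_mean (\<lambda>w. dir_deriv (\<lambda>z. F (z, \<tau>)) (x + (t - \<tau>) *\<^sub>R w) w)"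
      by (simp add: darboux_equation[OF slice] flip: sum_distrib_left)
  qed
  finally show ?thesis
    by (simp add: N_term_eq sum_divide_distrib[symmetric])
qed

section \<open>Time derivative and integration along the backward cone\<close>

text \<open>Every point of \<open>{0..}\<close> is a limit point of it from the right, so the
  derivative within the half-line is unique, even at 0, and the choice in \<open>time_deriv\<close>
  returns it.\<close>

lemma time_deriv_eqI:
  assumes "((\<lambda>s. F (x, s)) has_real_derivative D) (at \<tau> within {0..})" "\<tau> \<ge> 0"
  shows "time_deriv F x \<tau> = D"
  unfolding time_deriv_def
proof (rule some_equality)
  show "((\<lambda>s. F (x, s)) has_real_derivative D) (at \<tau> within {0..})" by (rule assms)
  have "at \<tau> within {0..} \<noteq> bot"
    using at_le[of "{\<tau><..}" "{0..}" \<tau>] trivial_limit_at_right_real[of \<tau>] \<open>\<tau> \<ge> 0\<close>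
    by (force simp: bot_unique)
  then show "E = D" if "((\<lambda>s. F (x, s)) has_real_derivative E) (at \<tau> within {0..})" for E
    using has_field_derivative_unique that assms(1) by blast
qed

lemma integral_radial_derivative:
  fixes F :: "'a::euclidean_space \<times> real \<Rightarrow> real"
  assumes F: "Ck_on (Suc k) (UNIV \<times> {0..}) F" and t: "t \<ge> 0"
  shows "integral {0..t} (\<lambda>\<tau>. sphere_mean (\<lambda>w. dir_deriv (\<lambda>z. F (z, \<tau>)) (x + (t - \<tau>) *\<^sub>R w) w))
    = integral {0..t} (\<lambda>\<tau>. sphere_mean (\<lambda>w. time_deriv F (x + (t - \<tau>) *\<^sub>R w) \<tau>))
      - F (x, t) + sphere_mean (\<lambda>w. F (x + t *\<^sub>R w, 0))"
proof -
  obtain Ft where Ft: "Ck_on k (UNIV \<times> {0..}) Ft"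
    and deriv: "\<And>y \<tau>. \<tau> \<ge> 0 \<Longrightarrow> (F has_derivative (\<lambda>(v, s). dir_deriv (\<lambda>z. F (z, \<tau>)) y v + s * Ft (y, \<tau>)))
      (at (y, \<tau>) within UNIV \<times> {0..})"
    using Ck_on_time_slice_deriv[OF F] by metis
  let ?D = "\<lambda>\<tau> w. dir_deriv (\<lambda>z. F (z, \<tau>)) (x + (t - \<tau>) *\<^sub>R w) w"
  let ?T = "\<lambda>\<tau> w. Ft (x + (t - \<tau>) *\<^sub>R w, \<tau>)"
  have lin: "dir_deriv (\<lambda>z. F (z, \<tau>)) y (- (c *\<^sub>R v)) = - c * dir_deriv (\<lambda>z. F (z, \<tau>)) y v" if "\<tau> \<ge> 0" for \<tau> y c v
    using dir_deriv_scaleR[OF Ck_on_time_slice[OF F that], of y "- c" v] by simp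
  have time: "time_deriv F y \<tau> = Ft (y, \<tau>)" if \<tau>: "\<tau> \<ge> 0" for y \<tau>
  proof (rule time_deriv_eqI[OF _ \<tau>])
    have sub: "(\<lambda>s. (y, s)) ` {0..} \<subseteq> UNIV \<times> {0::real..}" by auto
    have "((\<lambda>s. (y, s)) has_derivative (\<lambda>h. (0, h))) (at \<tau> within {0..})"
      by (auto intro!: derivative_eq_intros)
    from has_derivative_in_compose[OF this has_derivative_subset[OF deriv[OF \<tau>] sub]]
    show "((\<lambda>s. F (y, s)) has_real_derivative Ft (y, \<tau>)) (at \<tau> within {0..})"
      using lin[OF \<tau>, of y 0 0] by (simp add: has_field_derivative_def mult_commute_abs)
  qed
  note contT = continuous_on_integrand[OF Ft] and contD = continuous_on_integrand_radial[OF F]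
  have slice: "continuous_on (sphere 0 1) (?T \<tau>)" "continuous_on (sphere 0 1) (?D \<tau>)" if "\<tau> \<ge> 0" for \<tau>
    using that
    by (auto intro!: continuous_on_compose2[OF Ck_on_imp_continuous_on[OF Ft]]
        continuous_on_dir_deriv[OF Ck_on_time_slice[OF F]] continuous_intros)
  \<comment> \<open>At tau = t the sphere has shrunk to the apex (x, t), at tau = 0 it is the base
    of the cone. The theorem is applied to the mean rather than for each w, so no order of
    integration has to be exchanged.\<close>
  have FTC: "((\<lambda>\<tau>. sphere_mean (\<lambda>w. ?T \<tau> w - ?D \<tau> w)) has_integral
      sphere_mean (\<lambda>w. F (x + (t - t) *\<^sub>R w, t)) - sphere_mean (\<lambda>w. F (x + (t - 0) *\<^sub>R w, 0))) {0..t}"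
  proof (rule fundamental_theorem_of_calculus[OF t])
    fix s assume s: "s \<in> {0..t}"
    have "((\<lambda>\<tau>. sphere_mean (\<lambda>w. F (x + (t - \<tau>) *\<^sub>R w, \<tau>))) has_real_derivative
      sphere_mean (\<lambda>w. ?T s w - ?D s w)) (at s within {0..t})"
    proof (rule has_real_derivative_sphere_mean[OF _ s])
      fix \<tau> assume "\<tau> \<in> {0..t}"
      then have \<tau>: "\<tau> \<ge> 0" by simp
      show "continuous_on (sphere 0 1) (\<lambda>w. F (x + (t - \<tau>) *\<^sub>R w, \<tau>))"
        by (intro continuous_on_Ck_comp[OF Ck_on_time_slice[OF F \<tau>]] continuous_intros)
      fix w :: 'a
      have sub: "(\<lambda>\<tau>. (x + (t - \<tau>) *\<^sub>R w, \<tau>)) ` {0..t} \<subseteq> UNIV \<times> {0..}" by auto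
      have "((\<lambda>\<tau>. (x + (t - \<tau>) *\<^sub>R w, \<tau>)) has_derivative (\<lambda>h. (- (h *\<^sub>R w), h))) (at \<tau> within {0..t})"
        by (auto intro!: derivative_eq_intros)
      from has_derivative_in_compose[OF this has_derivative_subset[OF deriv[OF \<tau>] sub]]
      show "((\<lambda>\<tau>. F (x + (t - \<tau>) *\<^sub>R w, \<tau>)) has_real_derivative ?T \<tau> w - ?D \<tau> w) (at \<tau> within {0..t})"
        unfolding has_field_derivative_def split
        by (rule has_derivative_eq_rhs) (simp add: fun_eq_iff lin[OF \<tau>] algebra_simps)
    next
      have comp: "continuous_on ({0..t} \<times> sphere 0 1) (\<lambda>p. ((x + (t - fst p) *\<^sub>R snd p, fst p), snd p))"
        by (intro continuous_intros)
      show "continuous_on ({0..t} \<times> sphere 0 1) (\<lambda>(\<tau>, w). ?T \<tau> w - ?D \<tau> w)"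
        using continuous_on_compose2[OF contT comp] continuous_on_compose2[OF contD comp]
        unfolding split_beta by (intro continuous_intros) (auto simp: image_subset_iff)
    qed auto
    then show "((\<lambda>\<tau>. sphere_mean (\<lambda>w. F (x + (t - \<tau>) *\<^sub>R w, \<tau>))) has_vector_derivative
      sphere_mean (\<lambda>w. ?T s w - ?D s w)) (at s within {0..t})"
      by (simp add: has_real_derivative_iff_has_vector_derivative)
  qed
  have "integral {0..t} (\<lambda>\<tau>. sphere_mean (?T \<tau>)) - integral {0..t} (\<lambda>\<tau>. sphere_mean (?D \<tau>))
      = integral {0..t} (\<lambda>\<tau>. sphere_mean (?T \<tau>) - sphere_mean (?D \<tau>))"
    by (intro Henstock_Kurzweil_Integration.integral_diff[symmetric] integrable_continuous_real
        continuous_on_N_integrand_slice[OF contT] continuous_on_N_integrand_slice[OF contD])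
  also have "\<dots> = integral {0..t} (\<lambda>\<tau>. sphere_mean (\<lambda>w. ?T \<tau> w - ?D \<tau> w))"
    by (intro Henstock_Kurzweil_Integration.integral_cong) (simp add: sphere_mean_diff slice)
  also have "\<dots> = F (x, t) - sphere_mean (\<lambda>w. F (x + t *\<^sub>R w, 0))"
    using integral_unique[OF FTC] by simp
  finally have "integral {0..t} (\<lambda>\<tau>. sphere_mean (?D \<tau>))
      = integral {0..t} (\<lambda>\<tau>. sphere_mean (?T \<tau>)) - F (x, t) + sphere_mean (\<lambda>w. F (x + t *\<^sub>R w, 0))"
    by simp
  also have "integral {0..t} (\<lambda>\<tau>. sphere_mean (?T \<tau>))
      = integral {0..t} (\<lambda>\<tau>. sphere_mean (\<lambda>w. time_deriv F (x + (t - \<tau>) *\<^sub>R w) \<tau>))"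
    by (intro Henstock_Kurzweil_Integration.integral_cong) (simp add: time)
  finally show ?thesis .
qed

section \<open>Assembly of H and of the wave equation\<close>

lemma H_term_eq:
  fixes f g :: "'a::euclidean_space \<Rightarrow> real"
  assumes f: "Ck_on 3 UNIV f" and g: "Ck_on 2 UNIV g"
  shows "H_term \<epsilon> f g F x t = (real DIM('a) - 3) / (real DIM('a) - 2) *
    (integral {0..t} (\<lambda>\<tau>. sphere_mean (\<lambda>w. time_deriv F (x + (t - \<tau>) *\<^sub>R w) \<tau>))
     + sphere_mean (\<lambda>w. F (x + t *\<^sub>R w, 0))
     + \<epsilon> * (sphere_mean (\<lambda>w. laplacian f (x + t *\<^sub>R w))
        + (real DIM('a) - 2) * sphere_mean (\<lambda>w. dir_deriv g (x + t *\<^sub>R w) w)))"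
proof -
  have f: "Ck_on (Suc (Suc (Suc 0))) UNIV f" using f by (simp add: numeral_3_eq_3)
  have g: "Ck_on (Suc (Suc 0)) UNIV g" using g by (simp add: numeral_2_eq_2)
  let ?T = "\<lambda>\<tau>. sphere_mean (\<lambda>w. time_deriv F (x + (t - \<tau>) *\<^sub>R w) \<tau>)"
  have int: "integral {0..t} (\<lambda>\<tau>. omega_n DIM('a) * ?T \<tau>) = omega_n DIM('a) * integral {0..t} ?T"
    by simp
  have mean: "sphere_mean (\<lambda>w. laplacian f (x + t *\<^sub>R w) + (real DIM('a) - 2) * dir_deriv g (x + t *\<^sub>R w) w)
    = sphere_mean (\<lambda>w. laplacian f (x + t *\<^sub>R w)) + (real DIM('a) - 2) * sphere_mean (\<lambda>w. dir_deriv g (x + t *\<^sub>R w) w)"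
    by (simp add: sphere_mean_add sphere_mean_cmult continuous_intros continuous_on_dir_deriv[OF g]
        continuous_on_Ck_comp[OF Ck_on_laplacian[OF f]])
  define c where "c = (real DIM('a) - 3) / ((real DIM('a) - 2) * omega_n DIM('a))"
  have "H_term \<epsilon> f g F x t = c * omega_n DIM('a) *
    (integral {0..t} ?T + sphere_mean (\<lambda>w. F (x + t *\<^sub>R w, 0))
     + \<epsilon> * (sphere_mean (\<lambda>w. laplacian f (x + t *\<^sub>R w))
        + (real DIM('a) - 2) * sphere_mean (\<lambda>w. dir_deriv g (x + t *\<^sub>R w) w)))"
    unfolding H_term_def Let_def sphere_integral_eq_sphere_mean c_def[symmetric] int mean
    by (simp only: distrib_left mult_ac)
  moreover have "c * omega_n DIM('a) = (real DIM('a) - 3) / (real DIM('a) - 2)"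
    using omega_n_DIM_pos[where 'a='a] by (simp add: c_def)
  ultimately show ?thesis by simp
qed

text \<open>The second-order radial terms cancel, and for the first-order ones 2 - (n - 1) = 3 -
  n.\<close>

lemma N_term_wave_operator:
  fixes F :: "'a::euclidean_space \<times> real \<Rightarrow> real"
  assumes F: "Ck_on (Suc (Suc k)) (UNIV \<times> {0..}) F"
  shows "integral {0..t} (\<lambda>\<tau>.
      2 * sphere_mean (\<lambda>w. dir_deriv (\<lambda>z. F (z, \<tau>)) (x + (t - \<tau>) *\<^sub>R w) w)
      + (t - \<tau>) * sphere_mean (\<lambda>w. radial_second_deriv (\<lambda>z. F (z, \<tau>)) (x + (t - \<tau>) *\<^sub>R w) w))
    - integral {0..t} (\<lambda>\<tau>.
      (t - \<tau>) * sphere_mean (\<lambda>w. radial_second_deriv (\<lambda>z. F (z, \<tau>)) (x + (t - \<tau>) *\<^sub>R w) w)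
      + (real DIM('a) - 1) * sphere_mean (\<lambda>w. dir_deriv (\<lambda>z. F (z, \<tau>)) (x + (t - \<tau>) *\<^sub>R w) w))
    = (3 - real DIM('a)) * integral {0..t} (\<lambda>\<tau>. sphere_mean (\<lambda>w. dir_deriv (\<lambda>z. F (z, \<tau>)) (x + (t - \<tau>) *\<^sub>R w) w))"
  by (subst Henstock_Kurzweil_Integration.integral_diff[symmetric], (intro integrable_continuous_real continuous_intros
      continuous_on_N_integrand_slice[OF continuous_on_integrand_radial[OF F]]
      continuous_on_N_integrand_slice[OF continuous_on_integrand_radial_second[OF F]])+,
      subst integral_mult_right[symmetric])
    (simp add: algebra_simps)

theorem theorem2p1:
  fixes f g :: "'a::euclidean_space \<Rightarrow> real"
    and F :: "'a \<times> real \<Rightarrow> real"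
    and u :: "'a \<Rightarrow> real \<Rightarrow> real"
    and \<epsilon> :: real
  assumes "DIM('a) \<ge> 3"
    and "\<epsilon> > 0"
    and "Ck_on 3 UNIV f"
    and "Ck_on 2 UNIV g"
    and "Ck_on 2 (UNIV \<times> {0..}) F"
    and "\<And>x t. t \<ge> 0 \<Longrightarrow> u x t = \<epsilon> * V_term f g x t + N_term F x t"
  shows "(\<forall>x. \<forall>t\<ge>0. \<exists>utt lap.
            has_second_deriv_within (\<lambda>s. u x s) utt t {0..}
          \<and> (\<exists>D2. (\<forall>b\<in>Basis. has_second_deriv_within (\<lambda>s. u (x + s *\<^sub>R b) t) (D2 b) 0 UNIV)
                 \<and> lap = (\<Sum>b\<in>Basis. D2 b))
          \<and> utt - lap = F (x, t) - H_term \<epsilon> f g F x t)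
       \<and> (\<forall>x. u x 0 = \<epsilon> * f x
            \<and> ((\<lambda>s. u x s) has_real_derivative (\<epsilon> * g x)) (at 0 within {0..}))"
proof -
  have f3: "Ck_on (Suc (Suc (Suc 0))) UNIV f" using assms(3) by (simp add: numeral_3_eq_3)
  have g2: "Ck_on (Suc (Suc 0)) UNIV g" using assms(4) by (simp add: numeral_2_eq_2)
  have F2: "Ck_on (Suc (Suc 0)) (UNIV \<times> {0..}) F" using assms(5) by (simp add: numeral_2_eq_2)
  let ?n = "real DIM('a)"
  have n: "?n - 2 \<noteq> 0" using assms(1) by simp
  have "\<exists>utt lap. has_second_deriv_within (\<lambda>s. u x s) utt t {0..}
      \<and> (\<exists>D2. (\<forall>b\<in>Basis. has_second_deriv_within (\<lambda>s. u (x + s *\<^sub>R b) t) (D2 b) 0 UNIV)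
             \<and> lap = (\<Sum>b\<in>Basis. D2 b))
      \<and> utt - lap = F (x, t) - H_term \<epsilon> f g F x t" if t: "t \<ge> 0" for x t
  proof -
    define A where "A = sphere_mean (\<lambda>w. laplacian f (x + t *\<^sub>R w))"
    define B where "B = sphere_mean (\<lambda>w. dir_deriv (laplacian f) (x + t *\<^sub>R w) w)"
    define C where "C = sphere_mean (\<lambda>w. dir_deriv g (x + t *\<^sub>R w) w)"
    define R where "R = sphere_mean (\<lambda>w. radial_second_deriv g (x + t *\<^sub>R w) w)"
    define L where "L = sphere_mean (\<lambda>w. laplacian g (x + t *\<^sub>R w))"
    define I where "I = integral {0..t} (\<lambda>\<tau>.
      2 * sphere_mean (\<lambda>w. dir_deriv (\<lambda>z. F (z, \<tau>)) (x + (t - \<tau>) *\<^sub>R w) w)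
      + (t - \<tau>) * sphere_mean (\<lambda>w. radial_second_deriv (\<lambda>z. F (z, \<tau>)) (x + (t - \<tau>) *\<^sub>R w) w))"
    define J where "J = integral {0..t} (\<lambda>\<tau>.
      (t - \<tau>) * sphere_mean (\<lambda>w. radial_second_deriv (\<lambda>z. F (z, \<tau>)) (x + (t - \<tau>) *\<^sub>R w) w)
      + (?n - 1) * sphere_mean (\<lambda>w. dir_deriv (\<lambda>z. F (z, \<tau>)) (x + (t - \<tau>) *\<^sub>R w) w))"
    define T where "T = integral {0..t} (\<lambda>\<tau>. sphere_mean (\<lambda>w. time_deriv F (x + (t - \<tau>) *\<^sub>R w) \<tau>))"
    define Z where "Z = sphere_mean (\<lambda>w. F (x + t *\<^sub>R w, 0))"
    define Vbb where "Vbb b = V_term (\<lambda>y. dir_deriv (\<lambda>z. dir_deriv f z b) y b)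
      (\<lambda>y. dir_deriv (\<lambda>z. dir_deriv g z b) y b) x t" for b
    define Nbb where "Nbb b = N_term (\<lambda>(y, \<tau>). dir_deriv (\<lambda>z. dir_deriv (\<lambda>z. F (z, \<tau>)) z b) y b) x t" for b
    let ?utt = "\<epsilon> * ((A + t * B) / (?n - 2) + 2 * C + t * R) + 1 / (?n - 2) * (F (x, t) + I)"
    let ?D2 = "\<lambda>b. \<epsilon> * Vbb b + Nbb b"
    have "has_second_deriv_within (u x) ?utt t {0..}"
      using V_term_second_time_derivative[OF assms(3,4,1), of t "{0..}" x]
        N_term_second_time_derivative[OF F2 t, of x] t assms(6)
      unfolding A_def B_def C_def R_def I_def
      by (intro has_second_deriv_within_linear_combination) auto
    moreover have "has_second_deriv_within (\<lambda>s. u (x + s *\<^sub>R b) t) (?D2 b) 0 UNIV" if "b \<in> Basis" for b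
      using V_term_second_space_derivative[OF assms(3,4) that, of x t]
        N_term_second_space_derivative[OF F2 that, of x t] assms(6)[OF t]
      unfolding Vbb_def Nbb_def
      by (intro has_second_deriv_within_linear_combination) auto
    \<comment> \<open>Coefficients: A gets 1/(n - 2) - 1 = -(n - 3)/(n - 2), C gets 2 - (n - 1) =
      -(n - 3), both times epsilon, and F (x, t) gets 1/(n - 2) + (n - 3)/(n - 2) = 1. The terms
      with B and R cancel.\<close>
    moreover have "?utt - (\<Sum>b\<in>Basis. ?D2 b) = F (x, t) - H_term \<epsilon> f g F x t"
    proof -
      have "(\<Sum>b\<in>Basis. ?D2 b) = \<epsilon> * (t * B / (?n - 2) + A + t * L) + 1 / (?n - 2) * J"
        by (simp add: sum.distrib Vbb_def Nbb_def V_term_laplacian[OF assms(3,4)] N_term_laplacian[OF F2]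
            A_def B_def L_def J_def flip: sum_distrib_left)
      moreover have "t * L = t * R + (?n - 1) * C"
        unfolding L_def R_def C_def by (rule darboux_equation[OF g2, symmetric])
      moreover have "I = J + (3 - ?n) * (T - F (x, t) + Z)"
        using N_term_wave_operator[OF F2, of t x] integral_radial_derivative[OF F2 t, of x]
        by (simp add: I_def J_def T_def Z_def)
      moreover have "H_term \<epsilon> f g F x t = (?n - 3) / (?n - 2) * (T + Z + \<epsilon> * (A + (?n - 2) * C))"
        by (simp add: H_term_eq[OF assms(3,4)] T_def Z_def A_def C_def)
      \<comment> \<open>The final method decides polynomial identities, so the reciprocal becomes a
        variable with q * (n - 2) = 1.\<close>
      moreover define q where "q = inverse (?n - 2)"
      moreover from n have "q * (?n - 2) = 1" by (simp add: q_def)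
      ultimately show ?thesis
        unfolding divide_inverse q_def[symmetric] by algebra
    qed
    ultimately show ?thesis
      by (intro exI[of _ ?utt] exI[of _ "sum ?D2 Basis"] conjI exI[of _ ?D2] ballI refl)
  qed
  moreover have "u x 0 = \<epsilon> * f x" for x
    using assms(6)[of 0 x] by (simp add: V_term_eq[OF f3 g2] N_term_eq)
  moreover have "(u x has_real_derivative \<epsilon> * g x) (at 0 within {0..})" for x
  proof -
    \<comment> \<open>At t = 0 all terms weighted by t and the integral over \<open>{0..0}\<close>
      vanish; the mean of the constant g x remains.\<close>
    have "((\<lambda>s. \<epsilon> * V_term f g x s + N_term F x s) has_real_derivative \<epsilon> * g x + 0) (at 0 within {0..})"
      using V_term_time_derivative[OF f3 g2 assms(1), of x 0] N_term_time_derivative[OF F2, of 0 x]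
      by (intro DERIV_add DERIV_cmult) (auto intro: has_field_derivative_at_within)
    then have "((\<lambda>s. \<epsilon> * V_term f g x s + N_term F x s) has_derivative (*) (\<epsilon> * g x)) (at 0 within {0..})"
      by (simp add: has_field_derivative_def)
    \<comment> \<open>Agreement of u with the right-hand side on \<open>{0..}\<close> suffices for
      the derivative within that set.\<close>
    then show ?thesis
      unfolding has_field_derivative_def
      by (rule has_derivative_transform[rotated 2]) (simp_all add: assms(6))
  qed
  ultimately show ?thesis by simp
qed

end
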